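(* Let $\hat\rho=(\rho_1,\ldots,\rho_{n-1})$ be a subset of $n-1$ elements, of degrees $d_j=\deg\rho_j$, of a minimal set of homogeneous generators of the graded $S$-module $D_0(f)$ of Jacobian syzygies of a reduced hypersurface $V:f=0$ of degree $d$ in $\mathbb{P}^n$. Let $M(\hat\rho)'$ be the $(n-1)\times(n+1)$-matrix whose rows are the components of $\rho_1,\ldots,\rho_{n-1}$, and let $I(\hat\rho)\subset S$ be the ideal generated by all the $(n-1)$-minors of $M(\hat\rho)'$. Then the sequence of graded $S$-modules $$0\to S(-d_1)\oplus\cdots\oplus S(-d_{n-1})\xrightarrow{u} D_0(f)\xrightarrow{v} B(f,\hat\rho)(d_1+\ldots+d_{n-1}-d+1)\to 0$$ is exact if and only if $$\operatorname{height}(I(\hat\rho))\geq 2.$$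
   Context: Let $n\ge 2$, $S=\mathbb{C}[x_0,\ldots,x_n]$ with the standard grading, and let $V:f=0$ be a reduced hypersurface of degree $d\ge 3$ in $\mathbb{P}^n$ ($f\in S$ homogeneous of degree $d$ and square-free), which is not a cone over a hypersurface in $\mathbb{P}^{n-1}$. Write $f_j=\partial f/\partial x_j$ and $$D_0(f)=\{\rho=(a_0,\ldots,a_n)\in S^{n+1}: \sum_{j=0}^n a_jf_j=0\},$$ a graded $S$-module of rank $n$, where a syzygy $\rho$ is homogeneous of degree $e$ if all its components $a_j$ are homogeneous of degree $e$. For $\hat\rho=(\rho_1,\ldots,\rho_{n-1})$ a subset of a minimal set of homogeneous generators of $D_0(f)$ (no ordering of the degrees assumed), the maps are: $u(a_1,\ldots,a_{n-1})=\sum_{j=1}^{n-1}a_j\rho_j$; and for $\rho\in D_0(f)$, $M(\hat\rho,\rho)$ is the $(n+1)\times(n+1)$-matrix whose first row is $(x_0,\ldots,x_n)$, whose $j$-th row for $2\le j\le n$ consists of the components of $\rho_{j-1}$, and whose last row consists of the components of $\rho$; the polynomial $\det M(\hat\rho,\rho)$ is divisible by $f$, and $v(\rho)=\det M(\hat\rho,\rho)/f$. The Bourbaki ideal $B(f,\hat\rho)\subset S$ is the homogeneous ideal $\{v(\rho):\rho\in D_0(f)\}$ (the image of $v$, with degrees shifted so that it is a graded ideal of $S$). The height of the zero ideal is $0$. *)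

theory Defs
  imports
    "HOL-Library.Poly_Mapping"
    "HOL-Library.Extended_Nat"
    "HOL-Algebra.Ideal"
    "HOL-Algebra.Module"
    "HOL-Algebra.Divisibility"
    "Jordan_Normal_Form.Determinant"
    "Jordan_Normal_Form.DL_Submatrix"
begin

section \<open>Complex polynomials\<close>

text \<open>Polynomials in the variables \<open>x\<^sub>0, x\<^sub>1, \<dots>\<close>: a monomial is its finitely supported exponent
  function, a polynomial a finitely supported coefficient function.  The ring
  \<open>\<complex>[x\<^sub>0, \<dots>, x\<^sub>n]\<close> is the subring \<open>poly_ring n\<close>.\<close>

type_synonym mpoly = "(nat \<Rightarrow>\<^sub>0 nat) \<Rightarrow>\<^sub>0 complex"

definition Const :: "complex \<Rightarrow> mpoly" where
  "Const c = Poly_Mapping.single 0 c"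

definition Var :: "nat \<Rightarrow> mpoly" where
  "Var i = Poly_Mapping.single (Poly_Mapping.single i 1) 1"

definition poly_ring :: "nat \<Rightarrow> mpoly ring" where
  "poly_ring n = \<lparr>carrier = {p. \<forall>m\<in>Poly_Mapping.keys p. Poly_Mapping.keys m \<subseteq> {..n}},
                  monoid.mult = (*), one = 1, zero = 0, add = (+)\<rparr>"

definition total_deg :: "(nat \<Rightarrow>\<^sub>0 nat) \<Rightarrow> nat" where
  "total_deg m = (\<Sum>i\<in>Poly_Mapping.keys m. Poly_Mapping.lookup m i)"

text \<open>The zero polynomial is homogeneous of every degree; degrees are integers because of the
  shifts, and only the zero polynomial is homogeneous of a negative degree.\<close>

definition homogeneous :: "int \<Rightarrow> mpoly \<Rightarrow> bool" where
  "homogeneous k p \<longleftrightarrow> (\<forall>m\<in>Poly_Mapping.keys p. int (total_deg m) = k)"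

definition homogeneous_vec :: "int \<Rightarrow> mpoly vec \<Rightarrow> bool" where
  "homogeneous_vec k v \<longleftrightarrow> (\<forall>i<dim_vec v. homogeneous k (v $ i))"

definition partial_deriv :: "nat \<Rightarrow> mpoly \<Rightarrow> mpoly" where
  "partial_deriv i p =
     (\<Sum>m\<in>Poly_Mapping.keys p. Poly_Mapping.single (m - Poly_Mapping.single i 1)
                    (of_nat (Poly_Mapping.lookup m i) * Poly_Mapping.lookup p m))"

definition substitute :: "(nat \<Rightarrow> mpoly) \<Rightarrow> mpoly \<Rightarrow> mpoly" where
  "substitute \<sigma> p = (\<Sum>m\<in>Poly_Mapping.keys p. Const (Poly_Mapping.lookup p m) * (\<Prod>i\<in>Poly_Mapping.keys m. \<sigma> i ^ Poly_Mapping.lookup m i))"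


section \<open>Hypersurfaces\<close>

definition square_free :: "('a, 'b) ring_scheme \<Rightarrow> 'a \<Rightarrow> bool" where
  "square_free R f \<longleftrightarrow>
     (\<forall>g\<in>carrier R. (g \<otimes>\<^bsub>R\<^esub> g) divides\<^bsub>R\<^esub> f \<longrightarrow> g \<in> Units R)"

text \<open>\<open>f = 0\<close> is a cone over a hypersurface in \<open>\<complex>P\<^sup>n\<^sup>-\<^sup>1\<close> if, in suitable linear
  coordinates, \<open>f\<close> does not involve the last variable \<open>x\<^sub>n\<close>.\<close>

definition is_cone :: "nat \<Rightarrow> mpoly \<Rightarrow> bool" where
  "is_cone n f \<longleftrightarrow>
     (\<exists>A \<in> carrier_mat (n + 1) (n + 1). invertible_mat A \<and>
        substitute (\<lambda>i. \<Sum>j\<le>n. Const (A $$ (i, j)) * Var j) f \<in> carrier (poly_ring (n - 1)))"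


section \<open>Height of an ideal\<close>

text \<open>The supremum of the lengths \<open>k\<close> of chains \<open>P\<^sub>0 \<subset> P\<^sub>1 \<subset> \<dots> \<subset> P\<^sub>k = P\<close> of prime ideals.\<close>

definition prime_height :: "('a, 'b) ring_scheme \<Rightarrow> 'a set \<Rightarrow> enat" where
  "prime_height R P =
     Sup {enat k | k. \<exists>C :: nat \<Rightarrow> 'a set. (\<forall>i\<le>k. primeideal (C i) R) \<and>
                        (\<forall>i<k. C i \<subset> C (Suc i)) \<and> C k = P}"

definition ideal_height :: "('a, 'b) ring_scheme \<Rightarrow> 'a set \<Rightarrow> enat" where
  "ideal_height R I = (INF P \<in> {P. primeideal P R \<and> I \<subseteq> P}. prime_height R P)"


section \<open>Graded modules and exact sequences\<close>

text \<open>\<open>hcomp M k\<close> is the homogeneous component of degree \<open>k\<close>.  The record only carries the data;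
  the module and grading axioms hold for the concrete modules below.\<close>

record ('a, 'b) graded_module = "('a, 'b) module" +
  hcomp :: "int \<Rightarrow> 'b set"

text \<open>\<open>M(a)\<close>, with \<open>M(a)\<^sub>k = M\<^bsub>a+k\<^esub>\<close>.\<close>

definition shift :: "('a, 'b) graded_module \<Rightarrow> int \<Rightarrow> ('a, 'b) graded_module" where
  "shift M a = M\<lparr>hcomp := \<lambda>k. hcomp M (a + k)\<rparr>"

text \<open>The ring structure of the module records below (\<open>mult\<close>, \<open>one\<close>) is irrelevant, as in
  \<^const>\<open>module_vec\<close>.\<close>

definition direct_sum :: "nat \<Rightarrow> (nat \<Rightarrow> ('a, 'b) graded_module) \<Rightarrow> ('a, 'b vec) graded_module" where
  "direct_sum r M =
     \<lparr>carrier = {v \<in> carrier_vec r. \<forall>j<r. v $ j \<in> carrier (M j)},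
      monoid.mult = undefined,
      one = undefined,
      zero = vec r (\<lambda>j. \<zero>\<^bsub>M j\<^esub>),
      add = (\<lambda>v w. vec r (\<lambda>j. v $ j \<oplus>\<^bsub>M j\<^esub> w $ j)),
      module.smult = (\<lambda>a v. vec r (\<lambda>j. a \<odot>\<^bsub>M j\<^esub> (v $ j))),
      hcomp = (\<lambda>k. {v \<in> carrier_vec r. \<forall>j<r. v $ j \<in> hcomp (M j) k})\<rparr>"

text \<open>Homomorphisms of graded modules, of degree \<open>0\<close>.\<close>

definition graded_hom ::
  "('a, 'r) ring_scheme \<Rightarrow> ('a, 'b) graded_module \<Rightarrow> ('a, 'c) graded_module \<Rightarrow> ('b \<Rightarrow> 'c) \<Rightarrow> bool"
where
  "graded_hom R M N h \<longleftrightarrow>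
     h \<in> carrier M \<rightarrow> carrier N \<and>
     (\<forall>x\<in>carrier M. \<forall>y\<in>carrier M. h (x \<oplus>\<^bsub>M\<^esub> y) = h x \<oplus>\<^bsub>N\<^esub> h y) \<and>
     (\<forall>a\<in>carrier R. \<forall>x\<in>carrier M. h (a \<odot>\<^bsub>M\<^esub> x) = a \<odot>\<^bsub>N\<^esub> h x) \<and>
     (\<forall>k. h ` hcomp M k \<subseteq> hcomp N k)"

text \<open>Exactness of \<open>0 \<rightarrow> L \<rightarrow> M \<rightarrow> N \<rightarrow> 0\<close>.\<close>

definition graded_short_exact ::
  "('a, 'r) ring_scheme \<Rightarrow> ('a, 'b) graded_module \<Rightarrow> ('b \<Rightarrow> 'c) \<Rightarrow> ('a, 'c) graded_module \<Rightarrow>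
   ('c \<Rightarrow> 'd) \<Rightarrow> ('a, 'd) graded_module \<Rightarrow> bool"
where
  "graded_short_exact R L u M v N \<longleftrightarrow>
     graded_hom R L M u \<and> graded_hom R M N v \<and>
     inj_on u (carrier L) \<and>
     u ` carrier L = {x \<in> carrier M. v x = \<zero>\<^bsub>N\<^esub>} \<and>
     v ` carrier M = carrier N"

definition generates :: "('a, 'r) ring_scheme \<Rightarrow> ('a, 'b) graded_module \<Rightarrow> 'b set \<Rightarrow> bool" where
  "generates R M G \<longleftrightarrow>
     G \<subseteq> carrier M \<and> (\<forall>H. submodule H R M \<and> G \<subseteq> H \<longrightarrow> H = carrier M)"

definition minimal_homogeneous_generators ::
  "('a, 'r) ring_scheme \<Rightarrow> ('a, 'b) graded_module \<Rightarrow> 'b set \<Rightarrow> bool" where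
  "minimal_homogeneous_generators R M G \<longleftrightarrow>
     generates R M G \<and> (\<forall>g\<in>G. \<exists>k. g \<in> hcomp M k) \<and> (\<forall>G'. G' \<subset> G \<longrightarrow> \<not> generates R M G')"


section \<open>Jacobian syzygies and the Bourbaki ideal\<close>

definition poly_module :: "nat \<Rightarrow> (mpoly, mpoly) graded_module" where
  "poly_module n =
     \<lparr>carrier = carrier (poly_ring n), monoid.mult = (*), one = 1, zero = 0, add = (+), module.smult = (*),
      hcomp = (\<lambda>k. {p \<in> carrier (poly_ring n). homogeneous k p})\<rparr>"

definition syzygies :: "nat \<Rightarrow> mpoly \<Rightarrow> mpoly vec set" where
  "syzygies n f =
     {\<rho> \<in> carrier_vec (n + 1). (\<forall>j\<le>n. \<rho> $ j \<in> carrier (poly_ring n)) \<and>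
                                (\<Sum>j\<le>n. \<rho> $ j * partial_deriv j f) = 0}"

definition syzygy_module :: "nat \<Rightarrow> mpoly \<Rightarrow> (mpoly, mpoly vec) graded_module" where
  "syzygy_module n f =
     \<lparr>carrier = syzygies n f, monoid.mult = undefined, one = undefined,
      zero = 0\<^sub>v (n + 1), add = (+), module.smult = (\<cdot>\<^sub>v),
      hcomp = (\<lambda>k. {\<rho> \<in> syzygies n f. homogeneous_vec k \<rho>})\<rparr>"

definition syz_u :: "nat \<Rightarrow> mpoly vec list \<Rightarrow> mpoly vec \<Rightarrow> mpoly vec" where
  "syz_u n \<rho>s a = vec (n + 1) (\<lambda>i. \<Sum>j<length \<rho>s. a $ j * (\<rho>s ! j) $ i)"

definition syz_matrix :: "nat \<Rightarrow> mpoly vec list \<Rightarrow> mpoly vec \<Rightarrow> mpoly mat" where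
  "syz_matrix n \<rho>s \<rho> = mat_of_rows (n + 1) (vec (n + 1) Var # \<rho>s @ [\<rho>])"

text \<open>\<open>v(\<rho>) = det M / f\<close>: under the standing hypotheses \<open>f\<close> divides the determinant and is not a
  zero divisor, so the quotient exists and is unique.\<close>

definition syz_v :: "nat \<Rightarrow> mpoly \<Rightarrow> mpoly vec list \<Rightarrow> mpoly vec \<Rightarrow> mpoly" where
  "syz_v n f \<rho>s \<rho> = (THE q. q \<in> carrier (poly_ring n) \<and> det (syz_matrix n \<rho>s \<rho>) = q * f)"

definition bourbaki_ideal :: "nat \<Rightarrow> mpoly \<Rightarrow> mpoly vec list \<Rightarrow> mpoly set" where
  "bourbaki_ideal n f \<rho>s = syz_v n f \<rho>s ` syzygies n f"

definition bourbaki_module :: "nat \<Rightarrow> mpoly \<Rightarrow> mpoly vec list \<Rightarrow> (mpoly, mpoly) graded_module" where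
  "bourbaki_module n f \<rho>s =
     \<lparr>carrier = bourbaki_ideal n f \<rho>s, monoid.mult = (*), one = 1, zero = 0, add = (+), module.smult = (*),
      hcomp = (\<lambda>k. {p \<in> bourbaki_ideal n f \<rho>s. homogeneous k p})\<rparr>"

definition minors_ideal :: "nat \<Rightarrow> mpoly vec list \<Rightarrow> mpoly set" where
  "minors_ideal n \<rho>s =
     Idl\<^bsub>poly_ring n\<^esub> {det (submatrix (mat_of_rows (n + 1) \<rho>s) UNIV J) | J.
                          J \<subseteq> {..n} \<and> card J = length \<rho>s}"

end

theory Submission
  imports Defs
begin

text \<open>Factoriality is needed for a subset: \<open>S\<close> is a subring of a type of
  polynomials in infinitely many variables. Divisibility, primes and units are therefore taken
  relative to a carrier set, and variables are adjoined one at a time by Gauss's lemma.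
  Factorizations are never formed; arguments about prime factors are inductions that split off one
  prime.

  With C_k the cofactor of x_k in the first row, Cramer's rule reads det M * f_k = C_k * d * f. It
  is used twice. If det M = 0, every C_k vanishes, and these are, up to sign, the maximal minors of
  the other rows. In general, f divides f_k * det M for every k. Here square-freeness enters: a
  prime p divides f only once, and in characteristic zero it does not divide all its own
  derivatives, so it misses some f_k and has to divide det M.

  The dependence modulo p is built from cofactors, without a fraction field of S/(p). The same
  argument with {0} in place of the multiples of p shows that injectivity of u forces a nonzero
  minor.\<close>

text \<open>Let \<open>I\<close> be the ideal of the maximal minors of \<open>\<rho>\<^sub>1, \<dots>, \<rho>\<^bsub>n-1\<^esub>\<close>.  Since \<open>S\<close> is factorial, its primes of
  height at most one are \<open>0\<close> and the principal ones \<open>(p)\<close>, so height \<open>\<ge> 2\<close> means that \<open>I\<close> is nonzero and lies in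
  no \<open>(p)\<close>.

  If \<open>I \<subseteq> (p)\<close>, then the \<open>\<rho>\<^sub>i\<close> are dependent modulo \<open>p\<close>: some \<open>\<Sum> c\<^sub>i \<rho>\<^sub>i = p \<sigma>\<close> where \<open>p\<close> does not divide all
  \<open>c\<^sub>i\<close>.  Then \<open>\<sigma>\<close> is a syzygy in the kernel of \<open>v\<close> that is not in the image of \<open>u\<close>.

  Conversely, let \<open>v(\<rho>) = 0\<close>.  As \<open>M(\<rho>)\<close> maps the gradient of \<open>f\<close> to \<open>(d f, 0, \<dots>, 0)\<close>, Cramer's rule shows
  that all maximal minors of \<open>\<rho>\<^sub>1, \<dots>, \<rho>\<^bsub>n-1\<^esub>, \<rho>\<close> vanish, so \<open>m \<rho>\<close> is in the image of \<open>u\<close> for every maximal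
  minor \<open>m\<close> of the \<open>\<rho>\<^sub>i\<close>.  The prime factors of one nonzero \<open>m\<close> cancel one by one, each against a minor it does
  not divide.  The same identity, applied modulo the prime factors of the square-free \<open>f\<close>, shows that
  \<open>f\<close> divides \<open>det M(\<rho>)\<close>.\<close>

section \<open>Factorial domains and Gauss's lemma\<close>

text \<open>The quotient has to lie in \<open>A\<close>, whereas the type class relation
  \<open>dvd\<close> would admit any quotient of the type. Units of \<open>A\<close> are expressed
  as \<open>dvd_in A u 1\<close>.\<close>

definition dvd_in :: "'a::comm_ring_1 set \<Rightarrow> 'a \<Rightarrow> 'a \<Rightarrow> bool" where
  "dvd_in A a b \<longleftrightarrow> (\<exists>c\<in>A. b = a * c)"

definition prime_in :: "'a::comm_ring_1 set \<Rightarrow> 'a \<Rightarrow> bool" where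
  "prime_in A p \<longleftrightarrow> p \<in> A \<and> p \<noteq> 0 \<and> \<not> dvd_in A p 1 \<and>
     (\<forall>a\<in>A. \<forall>b\<in>A. dvd_in A p (a * b) \<longrightarrow> dvd_in A p a \<or> dvd_in A p b)"

definition irreducible_in :: "'a::comm_ring_1 set \<Rightarrow> 'a \<Rightarrow> bool" where
  "irreducible_in A p \<longleftrightarrow> p \<in> A \<and> p \<noteq> 0 \<and> \<not> dvd_in A p 1 \<and>
     (\<forall>a\<in>A. \<forall>b\<in>A. p = a * b \<longrightarrow> dvd_in A a 1 \<or> dvd_in A b 1)"

lemma prime_inD:
  assumes "prime_in A p"
  shows "p \<in> A" "p \<noteq> 0" "\<not> dvd_in A p 1"
    "\<And>a b. a \<in> A \<Longrightarrow> b \<in> A \<Longrightarrow> dvd_in A p (a * b) \<Longrightarrow> dvd_in A p a \<or> dvd_in A p b"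
  using assms unfolding prime_in_def by blast+

locale subdomain =
  fixes A :: "'a::idom set"
  assumes zero_closed [simp, intro]: "0 \<in> A"
    and one_closed [simp, intro]: "1 \<in> A"
    and add_closed [simp, intro]: "a \<in> A \<Longrightarrow> b \<in> A \<Longrightarrow> a + b \<in> A"
    and mult_closed [simp, intro]: "a \<in> A \<Longrightarrow> b \<in> A \<Longrightarrow> a * b \<in> A"
    and uminus_closed [simp, intro]: "a \<in> A \<Longrightarrow> - a \<in> A"
begin

lemma diff_closed [simp, intro]: "a \<in> A \<Longrightarrow> b \<in> A \<Longrightarrow> a - b \<in> A"
  using add_closed[of a "- b"] by simp

lemma power_closed [simp, intro]: "a \<in> A \<Longrightarrow> a ^ n \<in> A"
  by (induction n) auto

lemma sum_closed [intro]: "(\<And>i. i \<in> I \<Longrightarrow> g i \<in> A) \<Longrightarrow> sum g I \<in> A"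
  by (induction I rule: infinite_finite_induct) auto

lemma prod_closed [intro]: "(\<And>i. i \<in> I \<Longrightarrow> g i \<in> A) \<Longrightarrow> prod g I \<in> A"
  by (induction I rule: infinite_finite_induct) auto

lemma of_nat_closed [simp, intro]: "of_nat n \<in> A"
  by (induction n) auto

lemma dvd_in_add: "dvd_in A p a \<Longrightarrow> dvd_in A p b \<Longrightarrow> dvd_in A p (a + b)"
  unfolding dvd_in_def by (metis add_closed distrib_left)

lemma dvd_in_uminus: "dvd_in A p a \<Longrightarrow> dvd_in A p (- a)"
  unfolding dvd_in_def by (metis uminus_closed mult_minus_right)

lemma dvd_in_diff: "dvd_in A p a \<Longrightarrow> dvd_in A p b \<Longrightarrow> dvd_in A p (a - b)"
  using dvd_in_add[of p a "- b"] dvd_in_uminus[of p b] by simp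

lemma dvd_in_multL: "dvd_in A p a \<Longrightarrow> b \<in> A \<Longrightarrow> dvd_in A p (a * b)"
  unfolding dvd_in_def by (metis mult_closed mult.assoc)

lemma dvd_in_multR: "dvd_in A p a \<Longrightarrow> b \<in> A \<Longrightarrow> dvd_in A p (b * a)"
  using dvd_in_multL[of p a b] by (simp add: mult.commute)

lemma dvd_in_zero [simp]: "dvd_in A p 0"
  unfolding dvd_in_def using zero_closed by force

lemma dvd_in_refl [simp]: "dvd_in A p p"
  unfolding dvd_in_def using one_closed by force

lemma dvd_in_sum: "(\<And>i. i \<in> I \<Longrightarrow> dvd_in A p (g i)) \<Longrightarrow> dvd_in A p (sum g I)"
  by (induction I rule: infinite_finite_induct) (auto intro: dvd_in_add)

lemma dvd_in_cancel: "c \<noteq> 0 \<Longrightarrow> dvd_in A (c * a) (c * b) \<longleftrightarrow> dvd_in A a b"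
  unfolding dvd_in_def by (simp add: mult.assoc)

lemma unit_dvd_in: "dvd_in A u 1 \<Longrightarrow> b \<in> A \<Longrightarrow> dvd_in A u b"
  using dvd_in_multL[of u 1 b] by simp

end

text \<open>The function \<open>N\<close> plays the role of the number of prime factors: being
  additive and zero exactly at units, it drops strictly when a nonunit factor is removed. This
  replaces a chain condition on divisors.\<close>

locale factorial_subdomain = subdomain A for A :: "'a::idom set" +
  assumes irreducible_imp_prime: "irreducible_in A p \<Longrightarrow> prime_in A p"
    and size_exists: "\<exists>N :: 'a \<Rightarrow> nat. (\<forall>a\<in>A - {0}. \<forall>b\<in>A - {0}. N (a * b) = N a + N b) \<and>
      (\<forall>a\<in>A - {0}. N a = 0 \<longleftrightarrow> dvd_in A a 1)"
begin

definition size_in :: "'a \<Rightarrow> nat" where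
  "size_in = (SOME N. (\<forall>a\<in>A - {0}. \<forall>b\<in>A - {0}. N (a * b) = N a + N b) \<and>
      (\<forall>a\<in>A - {0}. N a = 0 \<longleftrightarrow> dvd_in A a 1))"

lemma size_in_props: "(\<forall>a\<in>A - {0}. \<forall>b\<in>A - {0}. size_in (a * b) = size_in a + size_in b) \<and>
      (\<forall>a\<in>A - {0}. size_in a = 0 \<longleftrightarrow> dvd_in A a 1)"
  unfolding size_in_def by (rule someI_ex[OF size_exists])

lemma size_in_mult: "a \<in> A \<Longrightarrow> b \<in> A \<Longrightarrow> a \<noteq> 0 \<Longrightarrow> b \<noteq> 0 \<Longrightarrow>
    size_in (a * b) = size_in a + size_in b"
  using size_in_props by simp

lemma size_in_eq_0: "a \<in> A \<Longrightarrow> a \<noteq> 0 \<Longrightarrow> size_in a = 0 \<longleftrightarrow> dvd_in A a 1"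
  using size_in_props by simp

lemma prime_divisor_exists:
  assumes "c \<in> A" "c \<noteq> 0" "\<not> dvd_in A c 1"
  shows "\<exists>p. prime_in A p \<and> dvd_in A p c"
  using assms
proof (induction "size_in c" arbitrary: c rule: less_induct)
  case less
  show ?case
  proof (cases "irreducible_in A c")
    case True
    then show ?thesis using irreducible_imp_prime dvd_in_refl by blast
  next
    case False
    then obtain a b where ab: "a \<in> A" "b \<in> A" "c = a * b" "\<not> dvd_in A a 1" "\<not> dvd_in A b 1"
      using less.prems unfolding irreducible_in_def by blast
    then have nz: "a \<noteq> 0" "b \<noteq> 0" using less.prems by auto
    then have "size_in a < size_in c"
      using size_in_mult[of a b] size_in_eq_0[of b] ab by simp
    then obtain p where "prime_in A p" "dvd_in A p a"
      using less.hyps ab nz by blast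
    then show ?thesis using ab dvd_in_multL by blast
  qed
qed

text \<open>Induction along a prime factorization, one prime at a time. All later cancellations of
  prime factors take this form.\<close>

lemma factorial_induct [consumes 2, case_names unit prime]:
  assumes "c \<in> A" "c \<noteq> 0"
    and unit: "\<And>u. u \<in> A \<Longrightarrow> dvd_in A u 1 \<Longrightarrow> P u"
    and prime: "\<And>p a. prime_in A p \<Longrightarrow> a \<in> A \<Longrightarrow> a \<noteq> 0 \<Longrightarrow> P a \<Longrightarrow> P (p * a)"
  shows "P c"
  using assms(1,2)
proof (induction "size_in c" arbitrary: c rule: less_induct)
  case less
  show ?case
  proof (cases "dvd_in A c 1")
    case True
    then show ?thesis using unit less by blast
  next
    case False
    then obtain p a where p: "prime_in A p" "c = p * a" "a \<in> A"
      using prime_divisor_exists less.prems unfolding dvd_in_def by blast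
    then have nz: "a \<noteq> 0" "p \<noteq> 0" using less.prems by auto
    have "size_in a < size_in c"
      using size_in_mult[of p a] size_in_eq_0[of p] p nz prime_inD[OF p(1)] by simp
    then show ?thesis using prime less.hyps p nz by blast
  qed
qed

end

section \<open>Univariate polynomials over a factorial domain\<close>

definition poly_over :: "'a::zero set \<Rightarrow> 'a poly set" where
  "poly_over A = {p. \<forall>i. coeff p i \<in> A}"

context subdomain
begin

lemma subdomain_poly_over: "subdomain (poly_over A)"
  by unfold_locales (auto simp: poly_over_def coeff_mult intro!: sum_closed)

lemma const_in_poly_over [simp]: "[:c:] \<in> poly_over A \<longleftrightarrow> c \<in> A"
  by (auto simp: poly_over_def coeff_pCons split: nat.splits)

lemma smult_in_poly_over [simp, intro]: "c \<in> A \<Longrightarrow> p \<in> poly_over A \<Longrightarrow> smult c p \<in> poly_over A"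
  by (auto simp: poly_over_def)

lemma monom_in_poly_over [simp, intro]: "c \<in> A \<Longrightarrow> monom c n \<in> poly_over A"
  by (auto simp: poly_over_def)

lemma coeff_in_A: "p \<in> poly_over A \<Longrightarrow> coeff p i \<in> A"
  by (simp add: poly_over_def)

lemma const_dvd_in_poly_over:
  assumes "p \<in> poly_over A"
  shows "dvd_in (poly_over A) [:c:] p \<longleftrightarrow> (\<forall>i. dvd_in A c (coeff p i))"
proof
  assume "dvd_in (poly_over A) [:c:] p"
  then show "\<forall>i. dvd_in A c (coeff p i)"
    unfolding dvd_in_def using coeff_in_A by auto
next
  assume "\<forall>i. dvd_in A c (coeff p i)"
  then obtain g where g: "\<And>i. g i \<in> A" "\<And>i. coeff p i = c * g i"
    unfolding dvd_in_def by metis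
  \<comment> \<open>The quotients are cut off at the degree of \<open>p\<close>, since for
    \<open>c = 0\<close> the chosen \<open>g i\<close> are arbitrary and may be nonzero for
    infinitely many \<open>i\<close>.\<close>
  define q where "q = (\<Sum>i\<le>degree p. monom (g i) i)"
  interpret B: subdomain "poly_over A" by (rule subdomain_poly_over)
  have "q \<in> poly_over A" unfolding q_def using g by (intro B.sum_closed) auto
  moreover have "p = [:c:] * q"
  proof -
    have "p = (\<Sum>i\<le>degree p. monom (coeff p i) i)" by (simp add: poly_as_sum_of_monoms)
    also have "\<dots> = [:c:] * q"
      unfolding q_def sum_distrib_left by (rule sum.cong) (simp_all add: g smult_monom)
    finally show ?thesis .
  qed
  ultimately show "dvd_in (poly_over A) [:c:] p" unfolding dvd_in_def by blast
qed

lemma const_dvd_in_const: "d \<in> A \<Longrightarrow> dvd_in (poly_over A) [:c:] [:d:] \<longleftrightarrow> dvd_in A c d"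
  by (subst const_dvd_in_poly_over) (auto simp: coeff_pCons split: nat.splits)

lemma unit_in_poly_over:
  assumes "p \<in> poly_over A"
  shows "dvd_in (poly_over A) p 1 \<longleftrightarrow> degree p = 0 \<and> dvd_in A (lead_coeff p) 1"
proof
  assume "dvd_in (poly_over A) p 1"
  then obtain q where q: "q \<in> poly_over A" "1 = p * q" unfolding dvd_in_def by blast
  then have "p \<noteq> 0" "q \<noteq> 0" by auto
  then have "degree p + degree q = 0" using q degree_mult_eq[of p q] by simp
  moreover have "1 = lead_coeff p * lead_coeff q"
    using q by (metis lead_coeff_mult lead_coeff_1)
  ultimately show "degree p = 0 \<and> dvd_in A (lead_coeff p) 1"
    unfolding dvd_in_def using coeff_in_A q by blast
next
  assume a: "degree p = 0 \<and> dvd_in A (lead_coeff p) 1"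
  then obtain c where "p = [:c:]" by (metis degree_eq_zeroE)
  then show "dvd_in (poly_over A) p 1"
    using a const_dvd_in_const[of 1 c] by (simp add: one_pCons)
qed

text \<open>Gauss's lemma. If \<open>c\<close> divided neither factor, let i and j be the first
  indices of coefficients it does not divide. In coefficient i + j of the product all other terms
  contain an earlier coefficient of one factor, so \<open>c\<close> would divide the product of the
  two chosen ones.\<close>

lemma prime_in_poly_over_const:
  assumes "prime_in A c"
  shows "prime_in (poly_over A) [:c:]"
proof -
  note c = prime_inD[OF assms]
  interpret B: subdomain "poly_over A" by (rule subdomain_poly_over)
  have "dvd_in (poly_over A) [:c:] a \<or> dvd_in (poly_over A) [:c:] b"
    if ab: "a \<in> poly_over A" "b \<in> poly_over A" "dvd_in (poly_over A) [:c:] (a * b)" for a b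
  proof (rule ccontr)
    assume "\<not> ?thesis"
    then have ex: "\<exists>i. \<not> dvd_in A c (coeff a i)" "\<exists>i. \<not> dvd_in A c (coeff b i)"
      using const_dvd_in_poly_over ab by auto
    define i where "i = (LEAST i. \<not> dvd_in A c (coeff a i))"
    define j where "j = (LEAST i. \<not> dvd_in A c (coeff b i))"
    have i: "\<not> dvd_in A c (coeff a i)" "\<And>k. k < i \<Longrightarrow> dvd_in A c (coeff a k)"
      unfolding i_def using LeastI_ex[OF ex(1)] not_less_Least by blast+
    have j: "\<not> dvd_in A c (coeff b j)" "\<And>k. k < j \<Longrightarrow> dvd_in A c (coeff b k)"
      unfolding j_def using LeastI_ex[OF ex(2)] not_less_Least by blast+
    have "dvd_in A c (coeff (a * b) (i + j))"
      using ab const_dvd_in_poly_over by auto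
    moreover have "coeff a i * coeff b j = coeff (a * b) (i + j) -
        (\<Sum>k\<in>{..i+j} - {i}. coeff a k * coeff b (i + j - k))"
      unfolding coeff_mult by (subst sum.remove[of _ i]) auto
    moreover have "dvd_in A c (\<Sum>k\<in>{..i+j} - {i}. coeff a k * coeff b (i + j - k))"
    proof (rule dvd_in_sum)
      fix k assume k: "k \<in> {..i+j} - {i}"
      then consider "k < i" | "i + j - k < j" by force
      then show "dvd_in A c (coeff a k * coeff b (i + j - k))"
        by cases (use i(2) j(2) dvd_in_multL dvd_in_multR coeff_in_A ab in auto)
    qed
    ultimately have "dvd_in A c (coeff a i * coeff b j)"
      by (simp only: dvd_in_diff)
    then show False using c(4) i j coeff_in_A ab by blast
  qed
  then show ?thesis
    unfolding prime_in_def using c const_dvd_in_const[of 1 c] by (auto simp: one_pCons)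
qed

end

context factorial_subdomain
begin

interpretation B: subdomain "poly_over A" by (rule subdomain_poly_over)

text \<open>An irreducible polynomial of positive degree is primitive: splitting off a nonunit
  constant would leave a unit, which has degree 0.\<close>

lemma prime_const_not_dvd_irreducible:
  assumes "irreducible_in (poly_over A) p" "degree p > 0" "prime_in A c"
  shows "\<not> dvd_in (poly_over A) [:c:] p"
proof
  assume "dvd_in (poly_over A) [:c:] p"
  then obtain q where q: "q \<in> poly_over A" "p = [:c:] * q" unfolding dvd_in_def by blast
  note c = prime_inD[OF prime_in_poly_over_const[OF assms(3)]]
  have "dvd_in (poly_over A) q 1"
    using assms(1) q c unfolding irreducible_in_def by blast
  then show False using unit_in_poly_over q assms(2) c by auto
qed

lemma irreducible_dvd_const_mult:
  assumes p: "irreducible_in (poly_over A) p" "degree p > 0"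
    and "c \<in> A" "c \<noteq> 0" and "h \<in> poly_over A" "dvd_in (poly_over A) p ([:c:] * h)"
  shows "dvd_in (poly_over A) p h"
  using assms(3-6)
proof (induction c arbitrary: h rule: factorial_induct)
  case (unit u)
  then obtain w where "w \<in> A" "1 = u * w" unfolding dvd_in_def by blast
  then have "h = ([:u:] * h) * [:w:]" by (simp add: mult.commute)
  then show ?case using unit \<open>w \<in> A\<close> B.dvd_in_multL by (metis const_in_poly_over)
next
  case (prime q a)
  have q: "prime_in (poly_over A) [:q:]" using prime_in_poly_over_const prime by blast
  obtain s where s: "s \<in> poly_over A" "[:q * a:] * h = p * s"
    using prime.prems unfolding dvd_in_def by blast
  have eq: "[:q:] * ([:a:] * h) = p * s" using s(2) by (simp add: mult.commute)
  have "dvd_in (poly_over A) [:q:] (p * s)"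
    unfolding dvd_in_def using eq prime by (metis B.mult_closed const_in_poly_over)
  moreover have "p \<in> poly_over A" using p unfolding irreducible_in_def by blast
  ultimately have "dvd_in (poly_over A) [:q:] s"
    using prime_inD(4)[OF q] s(1) prime_const_not_dvd_irreducible[OF p prime.hyps(1)] by blast
  then obtain t where t: "t \<in> poly_over A" "s = [:q:] * t" unfolding dvd_in_def by blast
  have "[:q:] * ([:a:] * h) = [:q:] * (p * t)" using eq t by (simp add: ac_simps)
  then have "[:a:] * h = p * t" using prime_inD(2)[OF q] mult_left_cancel by blast
  then have "dvd_in (poly_over A) p ([:a:] * h)" unfolding dvd_in_def using t(1) by blast
  then show ?case using prime by blast
qed

text \<open>Each prime factor of \<open>c\<close> divides \<open>q\<close> or \<open>g\<close> and
  is cancelled there. The constant \<open>c'\<close> collects the primes taken out of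
  \<open>g\<close>, so that \<open>g\<close> can be recovered from \<open>g'\<close>.\<close>

lemma irreducible_const_mult_factor:
  assumes p: "irreducible_in (poly_over A) p" "degree p > 0"
    and "c \<in> A" "c \<noteq> 0" and "q \<in> poly_over A" "g \<in> poly_over A" "[:c:] * p = q * g"
  shows "\<exists>q'\<in>poly_over A. \<exists>g'\<in>poly_over A. \<exists>c'\<in>A - {0}. p = q' * g' \<and> g = [:c':] * g'"
  using assms(3-7)
proof (induction c arbitrary: q g rule: factorial_induct)
  case (unit u)
  then obtain w where w: "w \<in> A" "1 = u * w" unfolding dvd_in_def by blast
  have "p = [:u * w:] * p" using w by (metis mult_1 one_pCons)
  also have "\<dots> = [:w:] * ([:u:] * p)" by (simp add: mult.commute)
  finally have "p = ([:w:] * q) * g" by (simp only: unit mult.assoc)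
  moreover have "[:w:] * q \<in> poly_over A" using w unit by simp
  ultimately show ?case using unit
    by (intro bexI[of _ "[:w:] * q"] bexI[of _ g] bexI[of _ 1]) (auto simp flip: one_pCons)
next
  case (prime r a)
  have r: "prime_in (poly_over A) [:r:]" using prime_in_poly_over_const prime by blast
  have pA: "p \<in> poly_over A" using p unfolding irreducible_in_def by blast
  have eq: "[:r:] * ([:a:] * p) = q * g" using prime.prems by (simp add: mult.commute)
  have "dvd_in (poly_over A) [:r:] (q * g)"
    unfolding dvd_in_def using eq prime pA by (metis B.mult_closed const_in_poly_over)
  then consider "dvd_in (poly_over A) [:r:] q" | "dvd_in (poly_over A) [:r:] g"
    using prime_inD(4)[OF r] prime.prems by blast
  then show ?case
  proof cases
    case 1
    then obtain t where t: "t \<in> poly_over A" "q = [:r:] * t" unfolding dvd_in_def by blast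
    have "[:r:] * ([:a:] * p) = [:r:] * (t * g)" using eq t by (simp add: ac_simps)
    then have "[:a:] * p = t * g" using prime_inD(2)[OF r] mult_left_cancel by blast
    then show ?thesis using prime.IH[OF t(1) prime.prems(2)] by blast
  next
    case 2
    then obtain t where t: "t \<in> poly_over A" "g = [:r:] * t" unfolding dvd_in_def by blast
    have "[:r:] * ([:a:] * p) = [:r:] * (q * t)" using eq t by (simp add: ac_simps)
    then have "[:a:] * p = q * t" using prime_inD(2)[OF r] mult_left_cancel by blast
    from prime.IH[OF prime.prems(1) t(1) this]
    obtain q' g' c' where *: "q' \<in> poly_over A" "g' \<in> poly_over A" "c' \<in> A - {0}"
        "p = q' * g'" "t = [:c':] * g'" by blast
    then have "g = [:r * c':] * g'" "r * c' \<in> A - {0}"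
      using t prime_inD(1,2)[OF prime.hyps(1)] by (auto simp: mult.commute)
    then show ?thesis using * by blast
  qed
qed

text \<open>Division with remainder without inverting leading coefficients: \<open>h\<close> is
  first multiplied by the leading coefficient of \<open>g\<close>. The remainders stay in
  \<open>J\<close>, so by minimality of the degree of \<open>g\<close> the process can only end at
  0.\<close>

lemma pseudo_division_min_degree:
  assumes J: "J \<subseteq> poly_over A" "\<And>a b. a \<in> J \<Longrightarrow> b \<in> J \<Longrightarrow> a - b \<in> J"
      "\<And>a b. a \<in> J \<Longrightarrow> b \<in> poly_over A \<Longrightarrow> b * a \<in> J"
    and g: "g \<in> J" "g \<noteq> 0" "\<And>h. h \<in> J \<Longrightarrow> h \<noteq> 0 \<Longrightarrow> degree g \<le> degree h"
    and "h \<in> J"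
  shows "\<exists>c\<in>A - {0}. \<exists>q\<in>poly_over A. [:c:] * h = q * g"
  using \<open>h \<in> J\<close>
\<comment> \<open>The measure separates 0 from the nonzero constants, which have the same
  \<open>degree\<close>.\<close>
proof (induction "if h = 0 then 0 else Suc (degree h)" arbitrary: h rule: less_induct)
  case less
  show ?case
  proof (cases "h = 0")
    case True
    then show ?thesis by (intro bexI[of _ 1] bexI[of _ 0]) auto
  next
    case False
    define k where "k = degree h - degree g"
    have le: "degree g \<le> degree h" using g(3) less.prems False by blast
    define m where "m = monom (lead_coeff h) k"
    define h' where "h' = [:lead_coeff g:] * h - m * g"
    have gA: "lead_coeff g \<in> A" "lead_coeff h \<in> A"
      using g(1) less.prems J(1) coeff_in_A by blast+
    have h': "h' \<in> J" unfolding h'_def m_def using J(2,3) less.prems g(1) gA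
      by (metis const_in_poly_over monom_in_poly_over)
    have "coeff h' i = 0" if "i \<ge> degree h" for i
    proof -
      have "coeff (m * g) i = lead_coeff h * coeff g (i - k)"
        using that unfolding m_def k_def by (simp add: coeff_monom_mult)
      moreover have "i = degree h \<and> i - k = degree g \<or> i > degree h \<and> i - k > degree g"
        using that le unfolding k_def by linarith
      ultimately show ?thesis unfolding h'_def by (auto simp: coeff_eq_0)
    qed
    then have "h' = 0 \<or> degree h' < degree h"
      by (intro eq_zero_or_degree_less degree_le) auto
    then have "(if h' = 0 then 0 else Suc (degree h')) < (if h = 0 then 0 else Suc (degree h))"
      using False by auto
    from less.hyps[OF this h'] obtain c q where cq: "c \<in> A - {0}" "q \<in> poly_over A" "[:c:] * h' = q * g"
      by blast
    have "[:c * lead_coeff g:] * h = [:c:] * h' + [:c:] * m * g"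
      unfolding h'_def by (simp add: algebra_simps)
    also have "\<dots> = (q + [:c:] * m) * g" using cq by (simp add: algebra_simps)
    finally have "[:c * lead_coeff g:] * h = (q + [:c:] * m) * g" .
    moreover have "q + [:c:] * m \<in> poly_over A"
      using cq gA by (intro B.add_closed B.mult_closed) (auto simp: m_def)
    moreover have "c * lead_coeff g \<in> A - {0}" using cq gA g(2) by auto
    ultimately show ?thesis by blast
  qed
qed

text \<open>No field of fractions is needed: by pseudo-division, an element \<open>g\<close> of least degree in the
  ideal \<open>(p, a)\<close> divides a constant multiple of every element of it, and constants cancel against
  the irreducible \<open>p\<close>.  So \<open>g\<close> is, up to a constant, either \<open>p\<close> or \<open>1\<close>.\<close>

lemma irreducible_in_poly_over_dvd_mult:
  assumes p: "irreducible_in (poly_over A) p" "degree p > 0"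
    and "dvd_in (poly_over A) p (a * b)" "a \<in> poly_over A" "b \<in> poly_over A"
  shows "dvd_in (poly_over A) p a \<or> dvd_in (poly_over A) p b"
proof -
  have pA: "p \<in> poly_over A" "p \<noteq> 0" using p unfolding irreducible_in_def by blast+
  define J where "J = {s * p + t * a | s t. s \<in> poly_over A \<and> t \<in> poly_over A}"
  have J: "J \<subseteq> poly_over A" unfolding J_def using pA assms by auto
  have J2: "x - y \<in> J" if xy: "x \<in> J" "y \<in> J" for x y
  proof -
    obtain s t s' t' where "x = s * p + t * a" "y = s' * p + t' * a"
      and *: "s \<in> poly_over A" "t \<in> poly_over A" "s' \<in> poly_over A" "t' \<in> poly_over A"
      using xy unfolding J_def by blast
    then have "x - y = (s - s') * p + (t - t') * a" by (simp add: algebra_simps)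
    then show ?thesis unfolding J_def using * by blast
  qed
  have J3: "y * x \<in> J" if xy: "x \<in> J" "y \<in> poly_over A" for x y
  proof -
    obtain s t where "x = s * p + t * a" and *: "s \<in> poly_over A" "t \<in> poly_over A"
      using xy unfolding J_def by blast
    then have "y * x = (y * s) * p + (y * t) * a" by (simp add: algebra_simps)
    then show ?thesis unfolding J_def using * xy by blast
  qed
  have "p = 1 * p + 0 * a" "a = 0 * p + 1 * a" by simp_all
  then have paJ: "p \<in> J" "a \<in> J" unfolding J_def using pA assms B.one_closed B.zero_closed by blast+
  define g where "g = arg_min degree (\<lambda>h. h \<in> J \<and> h \<noteq> 0)"
  have g: "g \<in> J" "g \<noteq> 0" "\<And>h. h \<in> J \<Longrightarrow> h \<noteq> 0 \<Longrightarrow> degree g \<le> degree h"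
    using arg_min_nat_lemma[of "\<lambda>h. h \<in> J \<and> h \<noteq> 0" p degree] paJ(1) pA(2)
    unfolding g_def by blast+
  obtain s t where st: "s \<in> poly_over A" "t \<in> poly_over A" "g = s * p + t * a"
    using g(1) unfolding J_def by blast
  have ps: "\<exists>c\<in>A - {0}. \<exists>q\<in>poly_over A. [:c:] * h = q * g" if "h \<in> J" for h
    by (rule pseudo_division_min_degree[OF J _ _ g(1,2) _ that]) (use J2 J3 g(3) in auto)
  obtain c q where c: "c \<in> A" "c \<noteq> 0" "q \<in> poly_over A" "[:c:] * p = q * g"
    using ps[OF paJ(1)] by auto
  have gA: "g \<in> poly_over A" using g(1) J by blast
  obtain q' g' c' where q': "q' \<in> poly_over A" "g' \<in> poly_over A" "c' \<in> A" "c' \<noteq> 0"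
      "p = q' * g'" "g = [:c':] * g'"
    using irreducible_const_mult_factor[OF p c(1,2,3) gA c(4)] by blast
  then consider "dvd_in (poly_over A) q' 1" | "dvd_in (poly_over A) g' 1"
    using p unfolding irreducible_in_def by blast
  then show ?thesis
  proof cases
    case 1
    then obtain w where w: "w \<in> poly_over A" "1 = q' * w" unfolding dvd_in_def by blast
    \<comment> \<open>Here \<open>g'\<close> is an associate of \<open>p\<close>, so
      \<open>p\<close> divides \<open>g\<close> and hence a constant multiple of
      \<open>a\<close>.\<close>
    have g': "g' = p * w" using w q'(5) by (metis mult.assoc mult.commute mult_1)
    obtain e r where e: "e \<in> A" "e \<noteq> 0" "r \<in> poly_over A" "[:e:] * a = r * g"
      using ps[OF paJ(2)] by auto
    have "[:e:] * a = p * (w * ([:c':] * r))"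
      unfolding e(4) q'(6) g' by (simp only: ac_simps)
    moreover have "w * ([:c':] * r) \<in> poly_over A" using w e q' by (intro B.mult_closed) auto
    ultimately have "dvd_in (poly_over A) p ([:e:] * a)" unfolding dvd_in_def by blast
    then show ?thesis using irreducible_dvd_const_mult[OF p e(1,2)] assms by blast
  next
    case 2
    then obtain w where w: "w \<in> poly_over A" "1 = g' * w" unfolding dvd_in_def by blast
    \<comment> \<open>Here \<open>g\<close> is a constant up to a unit, so the combination of
      \<open>p\<close> and \<open>a\<close> that represents \<open>g\<close> is a Bezout relation up
      to \<open>c'\<close>. Multiplied by \<open>b\<close>, both of its terms become divisible by
      \<open>p\<close>.\<close>
    have "[:c':] * b = (s * p + t * a) * w * b"
      using w st q' by (metis mult.assoc mult.right_neutral)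
    also have "\<dots> = p * (s * w * b) + (a * b) * (t * w)" by (simp add: algebra_simps)
    finally have "dvd_in (poly_over A) p ([:c':] * b)"
      using assms st w B.dvd_in_add B.dvd_in_multL B.dvd_in_refl
      by (metis B.mult_closed)
    then show ?thesis using irreducible_dvd_const_mult[OF p q'(3,4)] assms by blast
  qed
qed

lemma irreducible_const:
  assumes "irreducible_in (poly_over A) [:c:]"
  shows "irreducible_in A c"
proof -
  have c: "c \<in> A" "c \<noteq> 0" "\<not> dvd_in A c 1"
    using assms const_dvd_in_const[of 1 c] unfolding irreducible_in_def by (auto simp: one_pCons)
  moreover have "dvd_in A a 1 \<or> dvd_in A b 1" if "a \<in> A" "b \<in> A" "c = a * b" for a b
  proof -
    have "[:c:] = [:a:] * [:b:]" using that by simp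
    then have "dvd_in (poly_over A) [:a:] 1 \<or> dvd_in (poly_over A) [:b:] 1"
      using assms that unfolding irreducible_in_def by (metis const_in_poly_over)
    then show ?thesis using const_dvd_in_const[of 1] by (auto simp: one_pCons)
  qed
  ultimately show ?thesis unfolding irreducible_in_def by blast
qed

theorem factorial_poly_over: "factorial_subdomain (poly_over A)"
proof
  fix p assume p: "irreducible_in (poly_over A) p"
  show "prime_in (poly_over A) p"
  proof (cases "degree p = 0")
    case True
    then obtain c where "p = [:c:]" by (metis degree_eq_zeroE)
    then show ?thesis
      using p irreducible_const irreducible_imp_prime prime_in_poly_over_const by blast
  next
    case False
    then show ?thesis
      using p irreducible_in_poly_over_dvd_mult[OF p]
      unfolding prime_in_def irreducible_in_def by blast
  qed
next
  show "\<exists>N :: 'a poly \<Rightarrow> nat.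
      (\<forall>a\<in>poly_over A - {0}. \<forall>b\<in>poly_over A - {0}. N (a * b) = N a + N b) \<and>
      (\<forall>a\<in>poly_over A - {0}. N a = 0 \<longleftrightarrow> dvd_in (poly_over A) a 1)"
    \<comment> \<open>Prime factors are counted by the degree plus the size of the leading
      coefficient. Both are additive in a domain, and both vanish exactly at constant units.\<close>
    by (rule exI[of _ "\<lambda>p. degree p + size_in (lead_coeff p)"])
      (auto simp: degree_mult_eq coeff_mult_degree_sum size_in_mult size_in_eq_0 coeff_in_A unit_in_poly_over)
qed

end


section \<open>Factoriality of the polynomial ring\<close>

text \<open>Irreducibility, primality and size speak of products, 0 and 1 only, so a multiplicative
  bijection preserving 0 and 1 transports them.\<close>

lemma factorial_subdomain_bij:
  assumes "factorial_subdomain B" "subdomain A" and h: "bij_betw h B A"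
    and mult: "\<And>x y. x \<in> B \<Longrightarrow> y \<in> B \<Longrightarrow> h (x * y) = h x * h y"
    and h01: "h 0 = 0" "h 1 = 1"
  shows "factorial_subdomain A"
proof -
  interpret A: subdomain A by fact
  interpret B: factorial_subdomain B by fact
  have inj: "h x = h y \<longleftrightarrow> x = y" if "x \<in> B" "y \<in> B" for x y
    using h that by (metis bij_betw_inv_into_left)
  have hA: "h x \<in> A" if "x \<in> B" for x using h that by (metis bij_betwE)
  have surj: "\<exists>x\<in>B. y = h x" if "y \<in> A" for y using h that by (metis bij_betw_def imageE)
  have dvd: "dvd_in A (h x) (h y) \<longleftrightarrow> dvd_in B x y" if "x \<in> B" "y \<in> B" for x y
    unfolding dvd_in_def using that surj hA inj mult by (metis B.mult_closed)
  have dvd1: "dvd_in A (h x) 1 \<longleftrightarrow> dvd_in B x 1" if "x \<in> B" for x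
    using dvd[of x 1] that h01 by simp
  have nz: "h x = 0 \<longleftrightarrow> x = 0" if "x \<in> B" for x using inj[of x 0] that h01 by simp
  show ?thesis
  proof
    fix p assume p: "irreducible_in A p"
    then obtain q where q: "q \<in> B" "p = h q" using surj unfolding irreducible_in_def by blast
    have "irreducible_in B q"
      unfolding irreducible_in_def
    proof (intro conjI ballI impI)
      fix a b assume ab: "a \<in> B" "b \<in> B" "q = a * b"
      then have "p = h a * h b" using q mult by simp
      then have "dvd_in A (h a) 1 \<or> dvd_in A (h b) 1"
        using p ab hA unfolding irreducible_in_def by blast
      then show "dvd_in B a 1 \<or> dvd_in B b 1" using dvd1 ab by simp
    qed (use p q nz dvd1 in \<open>auto simp: irreducible_in_def\<close>)
    note pr = prime_inD[OF B.irreducible_imp_prime[OF this]]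
    show "prime_in A p"
      unfolding prime_in_def
    proof (intro conjI ballI impI)
      fix a b assume ab: "a \<in> A" "b \<in> A" "dvd_in A p (a * b)"
      obtain x y where xy: "x \<in> B" "y \<in> B" "a = h x" "b = h y" using surj ab by metis
      then have "dvd_in B q (x * y)" using ab q mult dvd[of q "x * y"] by simp
      then show "dvd_in A p a \<or> dvd_in A p b" using pr(4) xy q dvd by simp
    qed (use p in \<open>auto simp: irreducible_in_def\<close>)
  next
    define g where "g = inv_into B h"
    have g: "g y \<in> B" "h (g y) = y" if "y \<in> A" for y
      using h that unfolding g_def by (metis bij_betw_def inv_into_into, metis bij_betw_inv_into_right)
    have gm: "g (x * y) = g x * g y" if "x \<in> A" "y \<in> A" for x y
    proof -
      have "h (g (x * y)) = h (g x * g y)" using that by (simp add: g mult)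
      then show ?thesis using that g by (subst (asm) inj) auto
    qed
    have g0: "g y = 0 \<longleftrightarrow> y = 0" if "y \<in> A" for y using g nz that by metis
    show "\<exists>N :: 'b \<Rightarrow> nat. (\<forall>a\<in>A - {0}. \<forall>b\<in>A - {0}. N (a * b) = N a + N b) \<and>
        (\<forall>a\<in>A - {0}. N a = 0 \<longleftrightarrow> dvd_in A a 1)"
      by (rule exI[of _ "B.size_in \<circ> g"])
        (use g gm g0 dvd1 in \<open>auto simp: B.size_in_mult B.size_in_eq_0\<close>, metis+)
  qed
qed

text \<open>The bound is strict so that \<open>k = 0\<close> gives the constants, where the
  induction on the number of variables starts; \<open>poly_ring n\<close> has carrier
  \<open>polys_below (Suc n)\<close>.\<close>

definition polys_below :: "nat \<Rightarrow> mpoly set" where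
  "polys_below k = {p. \<forall>m\<in>Poly_Mapping.keys p. Poly_Mapping.keys m \<subseteq> {..<k}}"

lemma notin_keys_polys_below: "p \<in> polys_below k \<Longrightarrow> m \<in> Poly_Mapping.keys p \<Longrightarrow> k \<notin> Poly_Mapping.keys m"
  unfolding polys_below_def by blast

lemma carrier_poly_ring: "carrier (poly_ring n) = polys_below (Suc n)"
  by (simp add: poly_ring_def polys_below_def lessThan_Suc_atMost)

lemma poly_mapping_sum_monomials: "p = (\<Sum>m\<in>Poly_Mapping.keys p. Poly_Mapping.single m (Poly_Mapping.lookup p m))"
  by (rule poly_mapping_eqI) (auto simp: lookup_sum lookup_single when_def in_keys_iff)

lemma single_in_polys_below: "Poly_Mapping.keys m \<subseteq> {..<k} \<Longrightarrow> Poly_Mapping.single m c \<in> polys_below k"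
  by (auto simp: polys_below_def)

lemma subdomain_polys_below: "subdomain (polys_below k)"
proof
  fix a b assume a: "a \<in> polys_below k" and b: "b \<in> polys_below k"
  show "a + b \<in> polys_below k"
    using a b Poly_Mapping.keys_add[of a b] unfolding polys_below_def by blast
  show "a * b \<in> polys_below k"
    unfolding polys_below_def
  proof safe
    fix m i assume "m \<in> Poly_Mapping.keys (a * b)" "i \<in> Poly_Mapping.keys m"
    then obtain s t where "s \<in> Poly_Mapping.keys a" "t \<in> Poly_Mapping.keys b" "m = s + t" using keys_mult[of a b] by blast
    then show "i < k"
      using a b \<open>i \<in> Poly_Mapping.keys m\<close> Poly_Mapping.keys_add[of s t] unfolding polys_below_def by blast
  qed
next
  fix a assume "a \<in> polys_below k"
  then show "- a \<in> polys_below k" by (simp add: polys_below_def in_keys_iff)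
qed (auto simp: polys_below_def)

interpretation pb: subdomain "polys_below k" for k by (rule subdomain_polys_below)

lemma Var_in_polys_below: "i < k \<Longrightarrow> Var i \<in> polys_below k"
  unfolding Var_def by (rule single_in_polys_below) simp

lemma Var_power: "Var i ^ j = Poly_Mapping.single (Poly_Mapping.single i j) 1"
proof (induction j)
  case (Suc j)
  then show ?case by (simp add: Var_def mult_single flip: single_add)
qed simp

lemma lookup_mult_single: "Poly_Mapping.lookup (p * Poly_Mapping.single t a) (s + t) = Poly_Mapping.lookup p s * (a :: complex)"
  for p :: mpoly
proof -
  have "Poly_Mapping.lookup (Poly_Mapping.single m c * Poly_Mapping.single t a) (s + t) = Poly_Mapping.lookup (Poly_Mapping.single m c) s * a" for m c
    by (simp add: mult_single lookup_single when_def)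
  then show ?thesis
    by (subst (1 2) poly_mapping_sum_monomials[of p]) (simp add: sum_distrib_right lookup_sum)
qed

lemma lookup_mult_single_not_key:
  assumes "\<And>m. m \<in> Poly_Mapping.keys p \<Longrightarrow> s \<noteq> m + t"
  shows "Poly_Mapping.lookup (p * Poly_Mapping.single t a) s = 0"
  using assms keys_mult[of p "Poly_Mapping.single t a"] by (force simp: in_keys_iff split: if_splits)

text \<open>The coefficients of \<open>q\<close> are free of x_k, so a monomial with exponent
  \<open>j\<close> in x_k can arise only from the \<open>j\<close>-th coefficient. This gives
  injectivity of substituting x_k.\<close>

lemma lookup_poly_Var:
  assumes "q \<in> poly_over (polys_below k)" "k \<notin> Poly_Mapping.keys m"
  shows "Poly_Mapping.lookup (poly q (Var k)) (m + Poly_Mapping.single k j) = Poly_Mapping.lookup (coeff q j) m"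
proof -
  have *: "Poly_Mapping.lookup (coeff q i * Var k ^ i) (m + Poly_Mapping.single k j) = (if i = j then Poly_Mapping.lookup (coeff q j) m else 0)" for i
  proof (cases "i = j")
    case True
    then show ?thesis by (simp add: Var_power lookup_mult_single)
  next
    case False
    have "m + Poly_Mapping.single k j \<noteq> s + Poly_Mapping.single k i" if "s \<in> Poly_Mapping.keys (coeff q i)" for s
    proof
      assume "m + Poly_Mapping.single k j = s + Poly_Mapping.single k i"
      then have "Poly_Mapping.lookup (m + Poly_Mapping.single k j) k = Poly_Mapping.lookup (s + Poly_Mapping.single k i) k" by simp
      moreover have "Poly_Mapping.lookup m k = 0" "Poly_Mapping.lookup s k = 0"
        using assms(2) notin_keys_polys_below[OF pb.coeff_in_A[OF assms(1)] that]
        by (simp_all add: in_keys_iff)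
      ultimately show False using False by (simp add: lookup_add)
    qed
    then show ?thesis using False by (simp add: Var_power lookup_mult_single_not_key)
  qed
  show ?thesis
    unfolding poly_altdef lookup_sum * by (auto simp: coeff_eq_0)
qed

text \<open>The isomorphism between polynomials in one new variable over the first k variables and
  polynomials in k + 1 variables, realized by evaluation at \<open>Var k\<close>.\<close>

lemma bij_betw_poly_Var:
  "bij_betw (\<lambda>q. poly q (Var k)) (poly_over (polys_below k)) (polys_below (Suc k))"
  unfolding bij_betw_def
proof
  show "inj_on (\<lambda>q. poly q (Var k)) (poly_over (polys_below k))"
  proof (rule inj_onI, rule poly_eqI, rule poly_mapping_eqI)
    fix q r j m
    assume qr: "q \<in> poly_over (polys_below k)" "r \<in> poly_over (polys_below k)"
      "poly q (Var k) = poly r (Var k)"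
    show "Poly_Mapping.lookup (coeff q j) m = Poly_Mapping.lookup (coeff r j) m"
    proof (cases "k \<in> Poly_Mapping.keys m")
      case True
      then have "m \<notin> Poly_Mapping.keys (coeff q j)" "m \<notin> Poly_Mapping.keys (coeff r j)"
        using qr(1,2) notin_keys_polys_below pb.coeff_in_A by blast+
      then show ?thesis by (simp add: in_keys_iff)
    next
      case False
      then show ?thesis using qr lookup_poly_Var by metis
    qed
  qed
next
  let ?P = "poly_over (polys_below k)"
  interpret P: subdomain ?P by (rule pb.subdomain_poly_over)
  have sub: "polys_below k \<subseteq> polys_below (Suc k)" unfolding polys_below_def by force
  show "(\<lambda>q. poly q (Var k)) ` ?P = polys_below (Suc k)"
  proof (intro equalityI subsetI)
    fix p assume "p \<in> (\<lambda>q. poly q (Var k)) ` ?P"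
    then show "p \<in> polys_below (Suc k)"
      unfolding poly_altdef poly_over_def using sub
      by (auto intro!: pb.sum_closed pb.mult_closed pb.power_closed Var_in_polys_below)
  next
    fix p assume p: "p \<in> polys_below (Suc k)"
    have "\<exists>q\<in>?P. Poly_Mapping.single m c = poly q (Var k)" if "m \<in> Poly_Mapping.keys p" for m c
    proof -
      \<comment> \<open>The whole power of x_k is split off the monomial: the rest \<open>m'\<close>
        uses earlier variables only, and \<open>j\<close> becomes the degree in the new
        variable.\<close>
      define j where "j = Poly_Mapping.lookup m k"
      define m' where "m' = m - Poly_Mapping.single k j"
      have m: "m = m' + Poly_Mapping.single k j"
        unfolding m'_def j_def
        by (rule poly_mapping_eqI) (auto simp: lookup_add lookup_minus lookup_single when_def)
      have "Poly_Mapping.lookup m' i = 0" if "i \<ge> k" for i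
      proof (cases "i = k")
        case False
        moreover have "Poly_Mapping.keys m \<subseteq> {..<Suc k}" using p \<open>m \<in> Poly_Mapping.keys p\<close> unfolding polys_below_def by blast
        ultimately have "i \<notin> Poly_Mapping.keys m" using that by auto
        then show ?thesis unfolding m'_def using False by (simp add: lookup_minus lookup_single in_keys_iff)
      qed (simp add: m'_def j_def lookup_minus)
      then have "Poly_Mapping.single m' c \<in> polys_below k"
        by (intro single_in_polys_below subsetI) (metis in_keys_iff lessThan_iff not_le_imp_less)
      moreover have "Poly_Mapping.single m c = poly (monom (Poly_Mapping.single m' c) j) (Var k)"
        by (simp add: poly_monom Var_power mult_single m)
      ultimately show ?thesis by blast
    qed
    then have "\<forall>m\<in>Poly_Mapping.keys p. \<exists>q. q \<in> ?P \<and> Poly_Mapping.single m (Poly_Mapping.lookup p m) = poly q (Var k)" by blast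
    from bchoice[OF this] obtain q
      where q: "\<forall>m\<in>Poly_Mapping.keys p. q m \<in> ?P \<and> Poly_Mapping.single m (Poly_Mapping.lookup p m) = poly (q m) (Var k)" by blast
    have "p = poly (\<Sum>m\<in>Poly_Mapping.keys p. q m) (Var k)"
      by (subst poly_mapping_sum_monomials) (simp add: poly_sum q)
    then show "p \<in> (\<lambda>q. poly q (Var k)) ` ?P" using q by (blast intro: P.sum_closed)
  qed
qed

lemma unit_in_polys_below_0:
  assumes "p \<in> polys_below 0" "p \<noteq> 0"
  shows "dvd_in (polys_below 0) p 1"
proof -
  define c where "c = Poly_Mapping.lookup p 0"
  have p: "p = Poly_Mapping.single 0 c"
  proof (rule poly_mapping_eqI)
    fix m show "Poly_Mapping.lookup p m = Poly_Mapping.lookup (Poly_Mapping.single 0 c) m"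
      using assms(1) unfolding polys_below_def c_def
      by (cases "m = 0") (auto simp: in_keys_iff lookup_single)
  qed
  then have "c \<noteq> 0" using assms by auto
  then have "1 = p * Poly_Mapping.single 0 (inverse c)" unfolding p by (simp add: mult_single)
  then show ?thesis unfolding dvd_in_def using single_in_polys_below[of 0 0] by auto
qed

text \<open>Without variables every nonzero element is a unit, so there are no irreducibles and the
  zero size function serves. Each further variable is Gauss's lemma, transported along evaluation at
  x_k.\<close>

theorem factorial_polys_below: "factorial_subdomain (polys_below k)"
proof (induction k)
  case 0
  show ?case
  proof
    show "\<exists>N :: mpoly \<Rightarrow> nat. (\<forall>a\<in>polys_below 0 - {0}. \<forall>b\<in>polys_below 0 - {0}. N (a * b) = N a + N b) \<and>
        (\<forall>a\<in>polys_below 0 - {0}. N a = 0 \<longleftrightarrow> dvd_in (polys_below 0) a 1)"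
      by (rule exI[of _ "\<lambda>_. 0"]) (auto simp: unit_in_polys_below_0)
  qed (use unit_in_polys_below_0 in \<open>auto simp: irreducible_in_def\<close>)
next
  case (Suc k)
  interpret factorial_subdomain "polys_below k" by (rule Suc)
  show ?case
    by (rule factorial_subdomain_bij[OF factorial_poly_over subdomain_polys_below bij_betw_poly_Var]) auto
qed

interpretation pb: factorial_subdomain "polys_below k" for k by (rule factorial_polys_below)


section \<open>Derivatives and homogeneous polynomials\<close>

lemma lookup_partial_deriv:
  "Poly_Mapping.lookup (partial_deriv i p) m = of_nat (Poly_Mapping.lookup m i + 1) * Poly_Mapping.lookup p (m + Poly_Mapping.single i 1)"
proof -
  have *: "Poly_Mapping.lookup (Poly_Mapping.single (s - Poly_Mapping.single i 1) (of_nat (Poly_Mapping.lookup s i) * Poly_Mapping.lookup p s)) m =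
      (if s = m + Poly_Mapping.single i 1 then of_nat (Poly_Mapping.lookup m i + 1) * Poly_Mapping.lookup p s else 0)" for s
  \<comment> \<open>Subtraction of exponents is truncated, so a monomial \<open>s\<close> without
    x_i can also be sent to \<open>m\<close>; its contribution is killed by the factor
    \<open>Poly_Mapping.lookup s i\<close>.\<close>
  proof (cases "Poly_Mapping.lookup s i = 0")
    case True
    then have "s \<noteq> m + Poly_Mapping.single i 1" by (auto simp: lookup_add)
    then show ?thesis using True by simp
  next
    case False
    have "s - Poly_Mapping.single i 1 = m \<longleftrightarrow> s = m + Poly_Mapping.single i 1"
    proof
      assume "s - Poly_Mapping.single i 1 = m"
      then show "s = m + Poly_Mapping.single i 1"
        using False by (auto intro!: poly_mapping_eqI simp: lookup_add lookup_minus lookup_single when_def)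
    qed simp
    then show ?thesis by (auto simp: lookup_single when_def lookup_add)
  qed
  show ?thesis unfolding partial_deriv_def lookup_sum * by (auto simp: in_keys_iff)
qed

lemma partial_deriv_add: "partial_deriv i (p + q) = partial_deriv i p + partial_deriv i q"
  by (rule poly_mapping_eqI) (simp add: lookup_partial_deriv lookup_add algebra_simps)

lemma partial_deriv_zero [simp]: "partial_deriv i 0 = 0"
  by (simp add: partial_deriv_def)

lemma partial_deriv_sum: "partial_deriv i (sum g I) = (\<Sum>j\<in>I. partial_deriv i (g j))"
  by (induction I rule: infinite_finite_induct) (simp_all add: partial_deriv_add)

lemma partial_deriv_single: "partial_deriv i (Poly_Mapping.single m c) = Poly_Mapping.single (m - Poly_Mapping.single i 1) (of_nat (Poly_Mapping.lookup m i) * c)"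
  by (cases "c = 0") (simp_all add: partial_deriv_def)

lemma partial_deriv_closed:
  assumes "p \<in> polys_below k"
  shows "partial_deriv i p \<in> polys_below k"
  unfolding partial_deriv_def
proof (rule pb.sum_closed, rule single_in_polys_below)
  fix m assume "m \<in> Poly_Mapping.keys p"
  then have "Poly_Mapping.keys m \<subseteq> {..<k}" using assms unfolding polys_below_def by blast
  moreover have "Poly_Mapping.keys (m - Poly_Mapping.single i 1) \<subseteq> Poly_Mapping.keys m" by (auto simp: in_keys_iff lookup_minus)
  ultimately show "Poly_Mapping.keys (m - Poly_Mapping.single i 1) \<subseteq> {..<k}" by blast
qed

lemma partial_deriv_mult_single:
  "partial_deriv i (Poly_Mapping.single m c * Poly_Mapping.single m' c') =
     partial_deriv i (Poly_Mapping.single m c) * Poly_Mapping.single m' c' + Poly_Mapping.single m c * partial_deriv i (Poly_Mapping.single m' c')"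
proof -
  have *: "Poly_Mapping.single (s - Poly_Mapping.single i 1) (of_nat (Poly_Mapping.lookup s i) * a) * Poly_Mapping.single t b =
      Poly_Mapping.single (s + t - Poly_Mapping.single i 1) (of_nat (Poly_Mapping.lookup s i) * a * b)" for s t and a b :: complex
  proof (cases "Poly_Mapping.lookup s i = 0")
    case False
    then have "s - Poly_Mapping.single i 1 + t = s + t - Poly_Mapping.single i 1"
      by (auto intro!: poly_mapping_eqI simp: lookup_add lookup_minus lookup_single when_def)
    then show ?thesis by (simp add: mult_single)
  qed simp
  show ?thesis
    using *[of m c m' c'] *[of m' c' m c]
    by (simp add: mult_single partial_deriv_single lookup_add algebra_simps flip: single_add)
qed

lemma partial_deriv_mult: "partial_deriv i (p * q) = partial_deriv i p * q + p * partial_deriv i q"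
proof -
  define P where "P = (\<Sum>m\<in>Poly_Mapping.keys p. Poly_Mapping.single m (Poly_Mapping.lookup p m))"
  define Q where "Q = (\<Sum>m\<in>Poly_Mapping.keys q. Poly_Mapping.single m (Poly_Mapping.lookup q m))"
  have "partial_deriv i (P * Q) = partial_deriv i P * Q + P * partial_deriv i Q"
    unfolding P_def Q_def
    by (simp add: sum_product partial_deriv_sum partial_deriv_mult_single sum.distrib)
  then show ?thesis
    unfolding P_def Q_def by (simp flip: poly_mapping_sum_monomials)
qed

lemma total_deg_eq_sum: "finite S \<Longrightarrow> Poly_Mapping.keys m \<subseteq> S \<Longrightarrow> total_deg m = (\<Sum>i\<in>S. Poly_Mapping.lookup m i)"
  unfolding total_deg_def by (rule sum.mono_neutral_left) (auto simp: in_keys_iff)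

lemma total_deg_add: "total_deg (m + m') = total_deg m + total_deg m'"
proof -
  let ?S = "Poly_Mapping.keys m \<union> Poly_Mapping.keys m'"
  have "total_deg (m + m') = (\<Sum>i\<in>?S. Poly_Mapping.lookup (m + m') i)"
    using Poly_Mapping.keys_add[of m m'] by (intro total_deg_eq_sum) auto
  also have "\<dots> = (\<Sum>i\<in>?S. Poly_Mapping.lookup m i) + (\<Sum>i\<in>?S. Poly_Mapping.lookup m' i)"
    by (simp add: lookup_add sum.distrib)
  finally show ?thesis by (simp add: total_deg_eq_sum[of ?S])
qed

lemma total_deg_single [simp]: "total_deg (Poly_Mapping.single i j) = j"
  by (simp add: total_deg_def)

lemma total_deg_zero [simp]: "total_deg 0 = 0"
  by (simp add: total_deg_def)

lemma euler_identity:
  assumes "f \<in> polys_below (Suc n)" "homogeneous (int d) f"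
  shows "(\<Sum>j\<le>n. Var j * partial_deriv j f) = of_nat d * f"
proof -
  have "(\<Sum>j\<le>n. Var j * partial_deriv j (Poly_Mapping.single m c)) = of_nat d * Poly_Mapping.single m c" if m: "m \<in> Poly_Mapping.keys f" for m c
  proof -
    have "Var j * partial_deriv j (Poly_Mapping.single m c) = Poly_Mapping.single m (of_nat (Poly_Mapping.lookup m j) * c)" for j
    proof (cases "Poly_Mapping.lookup m j = 0")
      case False
      then have "Poly_Mapping.single j 1 + (m - Poly_Mapping.single j 1) = m"
        by (auto intro!: poly_mapping_eqI simp: lookup_add lookup_minus lookup_single when_def)
      then show ?thesis by (simp add: Var_def partial_deriv_single mult_single)
    qed (simp add: partial_deriv_single)
    then have "(\<Sum>j\<le>n. Var j * partial_deriv j (Poly_Mapping.single m c)) = Poly_Mapping.single m (of_nat (\<Sum>j\<le>n. Poly_Mapping.lookup m j) * c)"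
      by (intro poly_mapping_eqI) (simp add: lookup_sum lookup_single when_def sum_distrib_right)
    moreover have "(\<Sum>j\<le>n. Poly_Mapping.lookup m j) = d"
      using assms m total_deg_eq_sum[of "{..n}" m]
      unfolding polys_below_def homogeneous_def by (auto simp: lessThan_Suc_atMost)
    moreover have "of_nat d * Poly_Mapping.single m c = Poly_Mapping.single m (of_nat d * c)"
      by (simp add: mult_single flip: single_of_nat)
    ultimately show ?thesis by simp
  qed
  then have "(\<Sum>m\<in>Poly_Mapping.keys f. \<Sum>j\<le>n. Var j * partial_deriv j (Poly_Mapping.single m (Poly_Mapping.lookup f m))) =
      of_nat d * (\<Sum>m\<in>Poly_Mapping.keys f. Poly_Mapping.single m (Poly_Mapping.lookup f m))"
    by (simp add: sum_distrib_left)
  then have "(\<Sum>j\<le>n. Var j * partial_deriv j (\<Sum>m\<in>Poly_Mapping.keys f. Poly_Mapping.single m (Poly_Mapping.lookup f m))) =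
      of_nat d * (\<Sum>m\<in>Poly_Mapping.keys f. Poly_Mapping.single m (Poly_Mapping.lookup f m))"
    by (subst (asm) sum.swap) (simp add: partial_deriv_sum sum_distrib_left)
  then show ?thesis by (simp flip: poly_mapping_sum_monomials)
qed

section \<open>Homogeneous components and comparison of degrees\<close>

definition deg_part :: "nat \<Rightarrow> mpoly \<Rightarrow> mpoly" where
  "deg_part k p = (\<Sum>m\<in>{m\<in>Poly_Mapping.keys p. total_deg m = k}. Poly_Mapping.single m (Poly_Mapping.lookup p m))"

lemma lookup_deg_part: "Poly_Mapping.lookup (deg_part k p) m = (if total_deg m = k then Poly_Mapping.lookup p m else 0)"
  unfolding deg_part_def lookup_sum by (auto simp: lookup_single when_def in_keys_iff)

lemma keys_minus_deg_part: "m \<in> Poly_Mapping.keys (p - deg_part k p) \<Longrightarrow> m \<in> Poly_Mapping.keys p \<and> total_deg m \<noteq> k"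
  by (simp add: in_keys_iff lookup_minus lookup_deg_part split: if_splits)

lemma homogeneous_iff: "homogeneous k p \<longleftrightarrow> (\<forall>m. Poly_Mapping.lookup p m \<noteq> 0 \<longrightarrow> int (total_deg m) = k)"
  by (auto simp: homogeneous_def in_keys_iff)

lemma homogeneous_zero [simp]: "homogeneous k 0"
  by (simp add: homogeneous_iff)

lemma homogeneous_one [simp]: "homogeneous 0 1"
  by (simp add: homogeneous_def)

lemma homogeneous_add: "homogeneous k p \<Longrightarrow> homogeneous k q \<Longrightarrow> homogeneous k (p + q)"
  unfolding homogeneous_iff lookup_add by (metis add.right_neutral)

lemma homogeneous_uminus: "homogeneous k p \<Longrightarrow> homogeneous k (- p)"
  by (simp add: homogeneous_iff)

lemma homogeneous_sum: "(\<And>i. i \<in> I \<Longrightarrow> homogeneous k (g i)) \<Longrightarrow> homogeneous k (sum g I)"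
  by (induction I rule: infinite_finite_induct) (auto intro: homogeneous_add)

lemma homogeneous_mult:
  assumes "homogeneous k p" "homogeneous l q"
  shows "homogeneous (k + l) (p * q)"
  unfolding homogeneous_def
proof
  fix m assume "m \<in> Poly_Mapping.keys (p * q)"
  then obtain s t where "s \<in> Poly_Mapping.keys p" "t \<in> Poly_Mapping.keys q" "m = s + t" using keys_mult[of p q] by blast
  then show "int (total_deg m) = k + l"
    using assms by (simp add: homogeneous_def total_deg_add)
qed

lemma homogeneous_prod:
  "(\<And>i. i \<in> I \<Longrightarrow> homogeneous (e i) (g i)) \<Longrightarrow> homogeneous (sum e I) (prod g I)"
  by (induction I rule: infinite_finite_induct) (auto intro: homogeneous_mult)

lemma homogeneous_Var: "homogeneous 1 (Var i)"
  by (simp add: homogeneous_def Var_def)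

lemma homogeneous_deg_part: "homogeneous (int k) (deg_part k p)"
  by (simp add: homogeneous_iff lookup_deg_part)

text \<open>Let r be q without its component of degree k - l. Then r * f is homogeneous of degree k,
  but each of its monomials would need a monomial of degree k - l in r. So r * f vanishes, and with
  it r.\<close>

lemma homogeneous_dividend:
  assumes "homogeneous k (q * f)" "homogeneous l f" "f \<noteq> 0"
  shows "homogeneous (k - l) q"
proof -
  \<comment> \<open>For k < l the component is 0, as only 0 is homogeneous of a negative
    degree.\<close>
  define q' where "q' = (if k \<ge> l then deg_part (nat (k - l)) q else 0)"
  define r where "r = q - q'"
  have q': "homogeneous (k - l) q'"
    using homogeneous_deg_part[of "nat (k - l)" q] unfolding q'_def by auto
  have "homogeneous k (r * f)"
    using homogeneous_add[OF assms(1) homogeneous_uminus, of "q' * f"]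
      homogeneous_mult[OF q' assms(2)]
    unfolding r_def by (simp add: algebra_simps)
  have "Poly_Mapping.keys (r * f) = {}"
  proof (rule ccontr)
    assume "\<not> ?thesis"
    then obtain m where m: "m \<in> Poly_Mapping.keys (r * f)" by blast
    then obtain s t where st: "s \<in> Poly_Mapping.keys r" "t \<in> Poly_Mapping.keys f" "m = s + t" using keys_mult[of r f] by blast
    have "int (total_deg m) = k" "int (total_deg t) = l"
      using m st \<open>homogeneous k (r * f)\<close> assms(2) unfolding homogeneous_def by blast+
    then have "int (total_deg s) = k - l" using st by (simp add: total_deg_add)
    then have "Poly_Mapping.lookup r s = 0"
      unfolding r_def q'_def by (simp add: lookup_minus lookup_deg_part)
    then show False using st by (simp add: in_keys_iff)
  qed
  then have "r * f = 0" by (metis keys_zero poly_mapping_eqI in_keys_iff empty_iff lookup_zero)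
  then have "r = 0" using assms(3) by simp
  then show ?thesis using q' unfolding r_def by simp
qed

text \<open>In a domain the product of the top components of \<open>p\<close> and \<open>q\<close>
  is nonzero, so \<open>p * q\<close> has a monomial whose degree is at least the degree of
  \<open>p\<close>.\<close>

lemma total_deg_dividend_less:
  fixes p q :: mpoly
  assumes "\<And>m. m \<in> Poly_Mapping.keys (p * q) \<Longrightarrow> total_deg m < A" "q \<noteq> 0"
  shows "\<forall>m\<in>Poly_Mapping.keys p. total_deg m < A"
proof (rule ccontr)
  assume "\<not> ?thesis"
  then have p: "Poly_Mapping.keys p \<noteq> {}" "\<exists>m\<in>Poly_Mapping.keys p. A \<le> total_deg m" by (auto simp: not_less)
  define a where "a = Max (total_deg ` Poly_Mapping.keys p)"
  define b where "b = Max (total_deg ` Poly_Mapping.keys q)"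
  have q: "Poly_Mapping.keys q \<noteq> {}" using assms(2) by (metis in_keys_iff empty_iff lookup_zero poly_mapping_eqI)
  have a: "a \<in> total_deg ` Poly_Mapping.keys p" "\<And>m. m \<in> Poly_Mapping.keys p \<Longrightarrow> total_deg m \<le> a"
    unfolding a_def using p by (auto intro: Max_in)
  have b: "b \<in> total_deg ` Poly_Mapping.keys q" "\<And>m. m \<in> Poly_Mapping.keys q \<Longrightarrow> total_deg m \<le> b"
    unfolding b_def using q by (auto intro: Max_in)
  have "A \<le> a" using p(2) a(2) le_trans by blast
  have nz: "deg_part a p \<noteq> 0" "deg_part b q \<noteq> 0"
    using a(1) b(1) lookup_deg_part by (metis image_iff in_keys_iff lookup_zero)+
  then have "deg_part a p * deg_part b q \<noteq> 0" by simp
  then obtain m where m: "m \<in> Poly_Mapping.keys (deg_part a p * deg_part b q)"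
    by (metis in_keys_iff lookup_zero poly_mapping_eqI)
  then have deg: "total_deg m = a + b"
    using homogeneous_mult[OF homogeneous_deg_part[of a p] homogeneous_deg_part[of b q]]
    unfolding homogeneous_def by fastforce
  define p' where "p' = p - deg_part a p"
  define q' where "q' = q - deg_part b q"
  have low: "\<And>m. m \<in> Poly_Mapping.keys p' \<Longrightarrow> total_deg m < a" "\<And>m. m \<in> Poly_Mapping.keys q' \<Longrightarrow> total_deg m < b"
    unfolding p'_def q'_def
    by (metis a(2) keys_minus_deg_part le_neq_implies_less, metis b(2) keys_minus_deg_part le_neq_implies_less)
  have "m \<notin> Poly_Mapping.keys (p' * q)"
  proof
    assume "m \<in> Poly_Mapping.keys (p' * q)"
    then obtain s t where "s \<in> Poly_Mapping.keys p'" "t \<in> Poly_Mapping.keys q" "m = s + t" using keys_mult[of p' q] by blast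
    then show False using low(1)[of s] b(2)[of t] deg by (simp add: total_deg_add)
  qed
  moreover have "m \<notin> Poly_Mapping.keys (deg_part a p * q')"
  proof
    assume "m \<in> Poly_Mapping.keys (deg_part a p * q')"
    then obtain s t where st: "s \<in> Poly_Mapping.keys (deg_part a p)" "t \<in> Poly_Mapping.keys q'" "m = s + t"
      using keys_mult[of "deg_part a p" q'] by blast
    then have "total_deg s = a" by (auto simp: in_keys_iff lookup_deg_part split: if_splits)
    then show False using low(2)[of t] st deg by (simp add: total_deg_add)
  qed
  \<comment> \<open>All monomials of the first two summands have degree below a + b, so the monomial
    \<open>m\<close> of the last one cannot cancel.\<close>
  moreover have "p * q = p' * q + deg_part a p * q' + deg_part a p * deg_part b q"
    unfolding p'_def q'_def by (simp add: algebra_simps)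
  ultimately have "m \<in> Poly_Mapping.keys (p * q)" using m by (simp add: in_keys_iff lookup_add)
  then show False using assms(1)[of m] \<open>A \<le> a\<close> deg by simp
qed

text \<open>A derivative has smaller degree, so divisibility by \<open>p\<close> makes it zero. If
  all derivatives vanish, characteristic zero forces \<open>p\<close> to be constant, hence a
  unit.\<close>

lemma not_dvd_partial_deriv:
  assumes "p \<in> polys_below k" "p \<noteq> 0" "\<not> dvd_in (polys_below k) p 1"
  shows "\<exists>i<k. \<not> dvd_in (polys_below k) p (partial_deriv i p)"
proof (rule ccontr)
  assume "\<not> ?thesis"
  then have dvd: "\<And>i. i < k \<Longrightarrow> dvd_in (polys_below k) p (partial_deriv i p)" by blast
  define A where "A = Max (total_deg ` Poly_Mapping.keys p)"
  have p: "Poly_Mapping.keys p \<noteq> {}" using assms(2) by (metis in_keys_iff empty_iff lookup_zero poly_mapping_eqI)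
  have A: "A \<in> total_deg ` Poly_Mapping.keys p" "\<And>m. m \<in> Poly_Mapping.keys p \<Longrightarrow> total_deg m \<le> A"
    unfolding A_def using p by (auto intro: Max_in)
  have zero: "partial_deriv i p = 0" if "i < k" for i
  proof (rule ccontr)
    assume nz: "partial_deriv i p \<noteq> 0"
    obtain q where q: "partial_deriv i p = p * q"
      using dvd \<open>i < k\<close> unfolding dvd_in_def by blast
    have "total_deg m < A" if "m \<in> Poly_Mapping.keys (p * q)" for m
    proof -
      have "m + Poly_Mapping.single i 1 \<in> Poly_Mapping.keys p"
        using that lookup_partial_deriv[of i p m] by (auto simp: in_keys_iff simp flip: q)
      then show ?thesis using A(2)[of "m + Poly_Mapping.single i 1"] by (simp add: total_deg_add)
    qed
    then have "\<forall>m\<in>Poly_Mapping.keys p. total_deg m < A" by (rule total_deg_dividend_less) (use nz q in auto)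
    then show False using A(1) by auto
  qed
  have "m = 0" if "m \<in> Poly_Mapping.keys p" for m
  proof (rule ccontr)
    assume "m \<noteq> 0"
    then obtain i where i: "Poly_Mapping.lookup m i \<noteq> 0" by (metis lookup_zero poly_mapping_eqI)
    then have "i \<in> Poly_Mapping.keys m" by (simp add: in_keys_iff)
    then have "i < k" using that assms(1) unfolding polys_below_def by blast
    have "m - Poly_Mapping.single i 1 + Poly_Mapping.single i 1 = m"
      using i by (auto intro!: poly_mapping_eqI simp: lookup_add lookup_minus lookup_single when_def)
    then have "Poly_Mapping.lookup (partial_deriv i p) (m - Poly_Mapping.single i 1) \<noteq> 0"
      \<comment> \<open>Characteristic zero: the factor \<open>of_nat (_ + 1)\<close> is nonzero in
        the complex numbers.\<close>
      using that unfolding lookup_partial_deriv by (simp add: in_keys_iff del: of_nat_Suc)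
    then show False using zero[OF \<open>i < k\<close>] by simp
  qed
  then have "p \<in> polys_below 0" unfolding polys_below_def by auto
  then have "dvd_in (polys_below 0) p 1" using unit_in_polys_below_0 assms(2) by blast
  moreover have "polys_below 0 \<subseteq> polys_below k" unfolding polys_below_def by force
  ultimately show False using assms(3) unfolding dvd_in_def by blast
qed

section \<open>The polynomial ring as a commutative ring record\<close>

lemma poly_ring_simps [simp]:
  "x \<otimes>\<^bsub>poly_ring n\<^esub> y = x * y" "x \<oplus>\<^bsub>poly_ring n\<^esub> y = x + y"
  "\<one>\<^bsub>poly_ring n\<^esub> = 1" "\<zero>\<^bsub>poly_ring n\<^esub> = 0"
  by (simp_all add: poly_ring_def)

lemma cring_poly_ring: "cring (poly_ring n)"
proof (rule cringI)
  show "abelian_group (poly_ring n)"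
  proof (rule abelian_groupI)
    fix x assume "x \<in> carrier (poly_ring n)"
    then show "\<exists>y\<in>carrier (poly_ring n). y \<oplus>\<^bsub>poly_ring n\<^esub> x = \<zero>\<^bsub>poly_ring n\<^esub>"
      by (intro bexI[of _ "- x"]) (auto simp: carrier_poly_ring)
  qed (auto simp: carrier_poly_ring ac_simps)
  show "comm_monoid (poly_ring n)"
    by (rule comm_monoidI) (auto simp: carrier_poly_ring ac_simps)
qed (auto simp: distrib_right)


section \<open>Minors\<close>

lemma (in subdomain) det_closed:
  assumes "B \<in> carrier_mat k k" "\<And>i j. i < k \<Longrightarrow> j < k \<Longrightarrow> B $$ (i, j) \<in> A"
  shows "det B \<in> A"
  unfolding det_def'[OF assms(1)]
proof (intro sum_closed mult_closed prod_closed)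
  fix p i assume "p \<in> {p. p permutes {0..<k}}" "i \<in> {0..<k}"
  then show "B $$ (i, p i) \<in> A" using assms(2) by (auto dest: permutes_in_image)
qed (auto simp: sign_def)

lemma (in subdomain) cofactor_closed:
  assumes "B \<in> carrier_mat k k" "\<And>i j. i < k \<Longrightarrow> j < k \<Longrightarrow> B $$ (i, j) \<in> A" "i < k" "j < k"
  shows "cofactor B i j \<in> A"
  unfolding cofactor_def
  by (intro mult_closed power_closed uminus_closed one_closed det_closed[of _ "k - 1"])
    (use assms in \<open>auto simp: mat_delete_def\<close>)

text \<open>Choosing columns by \<open>s\<close> amounts to choosing them by \<open>c\<close> and
  multiplying by the 0/1 matrix of \<open>e\<close>. Repetitions and permutations of columns are
  thus handled alike, without sorting or signs.\<close>

lemma det_select_columns: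
  fixes M :: "nat \<Rightarrow> 'b \<Rightarrow> 'a::comm_ring_1"
  assumes "\<And>b. b < t \<Longrightarrow> e b < t \<and> s b = c (e b)"
  shows "det (mat t t (\<lambda>(a, b). M a (s b))) =
    det (mat t t (\<lambda>(a, b). M a (c b))) * det (mat t t (\<lambda>(a, b). if a = e b then 1 else 0))"
proof -
  have "mat t t (\<lambda>(a, b). M a (s b)) =
      mat t t (\<lambda>(a, b). M a (c b)) * mat t t (\<lambda>(a, b). if a = e b then 1 else 0)"
    by (rule eq_matI) (use assms in \<open>auto simp: scalar_prod_def if_distrib cong: if_cong\<close>)
  then show ?thesis by (simp add: det_mult[of _ t])
qed

lemma cofactor_last_column:
  "cofactor (mat (Suc t) (Suc t) (\<lambda>(a, b). M a ((s(t := j)) b))) i t =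
   cofactor (mat (Suc t) (Suc t) (\<lambda>(a, b). M a (s b))) i t"
proof -
  have "mat_delete (mat (Suc t) (Suc t) (\<lambda>(a, b). M a ((s(t := j)) b))) i t =
      mat_delete (mat (Suc t) (Suc t) (\<lambda>(a, b). M a (s b))) i t"
    by (rule eq_matI) (auto simp: mat_delete_def)
  then show ?thesis by (simp add: cofactor_def)
qed

text \<open>Laplace expansion along the last column. The cofactors do not see that column, so one
  family of coefficients works for all \<open>j\<close> simultaneously.\<close>

lemma det_bordered:
  fixes M :: "nat \<Rightarrow> 'b \<Rightarrow> 'a::comm_ring_1"
  shows "det (mat (Suc t) (Suc t) (\<lambda>(a, b). M a ((s(t := j)) b))) =
    (\<Sum>i\<le>t. cofactor (mat (Suc t) (Suc t) (\<lambda>(a, b). M a (s b))) i t * M i j)"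
  by (subst laplace_expansion_column[of _ "Suc t" t])
    (auto simp: cofactor_last_column[unfolded fun_upd_apply] lessThan_Suc_atMost mult.commute intro!: sum.cong)

lemma cofactor_corner:
  "cofactor (mat (Suc t) (Suc t) (\<lambda>(a, b). M a (s b))) t t = det (mat t t (\<lambda>(a, b). M a (s b)))"
proof -
  have "mat_delete (mat (Suc t) (Suc t) (\<lambda>(a, b). M a (s b))) t t = mat t t (\<lambda>(a, b). M a (s b))"
    by (rule eq_matI) (auto simp: mat_delete_def)
  moreover have "(-1 :: 'a) ^ (t + t) = 1" by (metis even_add minus_one_power_iff)
  ultimately show ?thesis by (simp add: cofactor_def)
qed

text \<open>Taking a nonvanishing minor of the first \<open>t\<close> rows with \<open>t\<close> maximal, the coefficients are
  the cofactors of the column that borders it.\<close>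

lemma (in subdomain) rows_dependent_mod:
  fixes M :: "nat \<Rightarrow> nat \<Rightarrow> 'a"
  assumes "1 \<notin> P" "\<And>i j. i < r \<Longrightarrow> j \<le> n \<Longrightarrow> M i j \<in> A"
    and minors: "\<And>s. (\<And>b. b < r \<Longrightarrow> s b \<le> n) \<Longrightarrow> det (mat r r (\<lambda>(a, b). M a (s b))) \<in> P"
  shows "\<exists>c. (\<forall>i<r. c i \<in> A) \<and> (\<exists>i<r. c i \<notin> P) \<and> (\<forall>j\<le>n. (\<Sum>i<r. c i * M i j) \<in> P)"
proof -
  \<comment> \<open>\<open>Q t\<close> concerns the minors of the first \<open>t\<close> rows, with
    columns in any order and repetitions allowed. \<open>Q 0\<close> fails because the empty
    determinant is 1.\<close>
  define Q where "Q t \<longleftrightarrow>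
    (\<forall>s. (\<forall>b<t. s b \<le> n) \<longrightarrow> det (mat t t (\<lambda>(a, b). M a (s b))) \<in> P)" for t
  have "Q r" using minors unfolding Q_def by blast
  moreover have "\<not> Q 0" using assms(1) unfolding Q_def by simp
  ultimately obtain t where t: "t < r" "\<not> Q t" "Q (Suc t)"
    using ex_least_nat_less[of Q r] by auto
  then obtain s where s: "\<And>b. b < t \<Longrightarrow> s b \<le> n" "det (mat t t (\<lambda>(a, b). M a (s b))) \<notin> P"
    unfolding Q_def by blast
  \<comment> \<open>The last column is a placeholder: only its cofactors are used, and they do not
    depend on it.\<close>
  define B where "B = mat (Suc t) (Suc t) (\<lambda>(a, b). M a ((s(t := 0)) b))"
  define c where "c i = (if i \<le> t then cofactor B i t else 0)" for i
  have B: "cofactor B i t = cofactor (mat (Suc t) (Suc t) (\<lambda>(a, b). M a (s b))) i t" for i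
    unfolding B_def by (rule cofactor_last_column)
  have "B $$ (i, j) \<in> A" if "i < Suc t" "j < Suc t" for i j
    unfolding B_def using that t(1) s(1) by (auto intro!: assms(2))
  moreover have "B \<in> carrier_mat (Suc t) (Suc t)" unfolding B_def by simp
  ultimately have "cofactor B i t \<in> A" if "i \<le> t" for i
    using that cofactor_closed[of B "Suc t" i t] by simp
  then have cA: "c i \<in> A" for i unfolding c_def by simp
  have "c t \<notin> P" using s(2) by (simp add: c_def B cofactor_corner)
  moreover have "(\<Sum>i<r. c i * M i j) \<in> P" if "j \<le> n" for j
  proof -
    have "(\<Sum>i<r. c i * M i j) = (\<Sum>i\<le>t. c i * M i j)"
      using t(1) by (intro sum.mono_neutral_right) (auto simp: c_def)
    also have "\<dots> = det (mat (Suc t) (Suc t) (\<lambda>(a, b). M a ((s(t := j)) b)))"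
      unfolding det_bordered by (rule sum.cong) (simp_all add: c_def B)
    also have "\<dots> \<in> P" using t(3) s(1) that unfolding Q_def by (auto simp: less_Suc_eq)
    finally show ?thesis .
  qed
  ultimately show ?thesis using cA t(1) by blast
qed

text \<open>Cramer's rule: apply adj(B) * B = det(B) * 1 to the vector \<open>g\<close>, which B
  maps to (c, 0, ..., 0).\<close>

lemma det_mult_row_kernel:
  fixes B :: "'a::comm_ring_1 mat"
  assumes B: "B \<in> carrier_mat N N" "0 < N" "k < N"
    and g: "\<And>i. i < N \<Longrightarrow> (\<Sum>j<N. B $$ (i, j) * g j) = (if i = 0 then c else 0)"
  shows "det B * g k = cofactor B 0 k * c"
proof -
  have *: "(\<Sum>i<N. cofactor B i k * B $$ (i, j)) = (if k = j then det B else 0)" if "j < N" for j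
  proof -
    have "(adj_mat B * B) $$ (k, j) = (det B \<cdot>\<^sub>m 1\<^sub>m N) $$ (k, j)" using adj_mat[OF B(1)] by simp
    then show ?thesis
      using B that by (simp add: adj_mat_def scalar_prod_def atLeast0LessThan cong: if_cong split: if_splits)
  qed
  have "det B * g k = (\<Sum>j<N. (\<Sum>i<N. cofactor B i k * B $$ (i, j)) * g j)"
    using B by (simp add: * if_distrib[of "\<lambda>x. x * _"] cong: if_cong)
  also have "\<dots> = (\<Sum>i<N. cofactor B i k * (\<Sum>j<N. B $$ (i, j) * g j))"
    unfolding sum_distrib_right sum_distrib_left by (subst sum.swap) (simp add: mult.assoc)
  also have "\<dots> = cofactor B 0 k * c"
    using B by (simp add: g if_distrib[of "\<lambda>x. _ * x"] cong: if_cong)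
  finally show ?thesis .
qed

text \<open>A choice of n among n + 1 columns misses some column k, so it factors through the matrix
  with row 0 and column k deleted, whose determinant is a cofactor up to sign. Here \<open>c\<close>
  lists the columns other than k and \<open>e\<close> gives positions in that list.\<close>

lemma det_select_delete_first_row:
  fixes B :: "'a::comm_ring_1 mat"
  assumes B: "B \<in> carrier_mat (Suc n) (Suc n)" and zero: "\<And>k. k \<le> n \<Longrightarrow> cofactor B 0 k = 0"
    and s: "\<And>b. b < n \<Longrightarrow> s b \<le> n"
  shows "det (mat n n (\<lambda>(a, b). B $$ (Suc a, s b))) = 0"
proof -
  have "card (s ` {..<n}) < card {..n}" using card_image_le[of "{..<n}" s] by simp
  then obtain k where k: "k \<le> n" "k \<notin> s ` {..<n}"
    by (metis atMost_iff card_mono finite_imageI finite_lessThan not_less subsetI)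
  define c where "c b = (if b < k then b else Suc b)" for b
  define e where "e b = (if s b < k then s b else s b - 1)" for b
  have "e b < n \<and> s b = c (e b)" if "b < n" for b
  proof -
    have "s b \<noteq> k" using k that by auto
    then show ?thesis using s[OF that] k(1) unfolding e_def c_def by auto
  qed
  then have "det (mat n n (\<lambda>(a, b). B $$ (Suc a, s b))) =
    det (mat n n (\<lambda>(a, b). B $$ (Suc a, c b))) * det (mat n n (\<lambda>(a, b). if a = e b then 1 else 0))"
    by (rule det_select_columns)
  also have "mat n n (\<lambda>(a, b). B $$ (Suc a, c b)) = mat_delete B 0 k"
    using B by (intro eq_matI) (auto simp: mat_delete_def c_def)
  also have "det (mat_delete B 0 k) = 0"
  proof -
    have "(-1) ^ k * (-1) ^ k = (1::'a)" by (simp flip: power_mult_distrib)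
    moreover have "(-1) ^ k * det (mat_delete B 0 k) = 0"
      using zero[OF k(1)] by (simp add: cofactor_def)
    ultimately show ?thesis by (metis mult.assoc mult_1 mult_zero_right)
  qed
  finally show ?thesis by simp
qed

lemma submatrix_rows:
  assumes "J \<subseteq> {..n}" "card J = length vs"
  shows "submatrix (mat_of_rows (n + 1) vs) UNIV J =
    mat (length vs) (length vs) (\<lambda>(a, b). vs ! a $ pick J b)"
proof -
  have J: "{j. j < Suc n \<and> j \<in> J} = J" using assms(1) by auto
  have "pick J b < n + 1" if "b < length vs" for b
    using pick_in_set_le[of b J] that assms by (metis atMost_iff le_imp_less_Suc Suc_eq_plus1 subsetD)
  then show ?thesis
    by (intro eq_matI) (auto simp: submatrix_def J assms(2) pick_UNIV mat_of_rows_index)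
qed

text \<open>Links arbitrary column choices \<open>s\<close> to the minors indexed by sets that
  generate the minors ideal. If \<open>s\<close> repeats a column, \<open>J\<close> is any set of
  the right size containing its values, and the cofactor \<open>u\<close> is then 0.\<close>

lemma (in subdomain) det_select_minor:
  fixes vs :: "'a vec list"
  assumes s: "\<And>b. b < length vs \<Longrightarrow> s b \<le> n" and "length vs \<le> n + 1"
  shows "\<exists>J u. J \<subseteq> {..n} \<and> card J = length vs \<and> u \<in> A \<and>
    det (mat (length vs) (length vs) (\<lambda>(a, b). vs ! a $ s b)) =
      det (submatrix (mat_of_rows (n + 1) vs) UNIV J) * u"
proof -
  let ?r = "length vs"
  obtain J where J: "s ` {..<?r} \<subseteq> J" "J \<subseteq> {..n}" "card J = ?r"
    using exists_subset_between[of "s ` {..<?r}" ?r "{..n}"] card_image_le[of "{..<?r}" s] assms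
    by auto
  define e where "e b = card {a\<in>J. a < s b}" for b
  have fin: "finite J" using J(2) finite_subset by blast
  have e: "e b < ?r \<and> s b = pick J (e b)" if "b < ?r" for b
  proof -
    have sb: "s b \<in> J" using J that by blast
    then have "{a\<in>J. a < s b} \<subset> J" by auto
    then have "e b < card J" unfolding e_def using fin by (intro psubset_card_mono)
    then show ?thesis using pick_card_in_set[OF sb] J(3) unfolding e_def by simp
  qed
  have "det (mat ?r ?r (\<lambda>(a, b). vs ! a $ s b)) =
      det (mat ?r ?r (\<lambda>(a, b). vs ! a $ pick J b)) *
      det (mat ?r ?r (\<lambda>(a, b). if a = e b then 1 else 0))"
    by (rule det_select_columns[where M = "\<lambda>a j. vs ! a $ j"]) (rule e)
  moreover have "det (mat ?r ?r (\<lambda>(a, b). if a = e b then 1 else (0::'a))) \<in> A"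
    by (rule det_closed[of _ ?r]) auto
  ultimately show ?thesis using J submatrix_rows by metis
qed


section \<open>Height at least two\<close>

text \<open>A supremum of naturals reaches 2 only if a member does, and of a longer chain the last
  two inclusions suffice. For a non-prime \<open>P\<close> there are no chains, so the height is
  0.\<close>

lemma prime_height_ge_2_iff:
  "2 \<le> prime_height R P \<longleftrightarrow> primeideal P R \<and>
     (\<exists>Q0 Q1. primeideal Q0 R \<and> primeideal Q1 R \<and> Q0 \<subset> Q1 \<and> Q1 \<subset> P)"
    (is "?L \<longleftrightarrow> ?R")
proof
  assume L: ?L
  have "\<exists>k C. 2 \<le> k \<and> (\<forall>i\<le>k. primeideal (C i) R) \<and> (\<forall>i<k. C i \<subset> C (Suc i)) \<and> C k = P"
  proof (rule ccontr)
    assume *: "\<not> ?thesis"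
    have "prime_height R P \<le> enat 1"
      unfolding prime_height_def
    proof (rule Sup_least, clarify)
      fix k C assume "\<forall>i\<le>k. primeideal (C i) R" "\<forall>i<k. C i \<subset> C (Suc i)" "P = C k"
      then have "\<not> 2 \<le> k" using * by blast
      then show "enat k \<le> enat 1" by simp
    qed
    then have "(2 :: enat) \<le> enat 1" using L by (rule order_trans[rotated])
    then show False by (simp add: numeral_eq_enat)
  qed
  then obtain k C where C: "2 \<le> k" "\<forall>i\<le>k. primeideal (C i) R" "\<forall>i<k. C i \<subset> C (Suc i)" "C k = P"
    by blast
  then obtain l where l: "k = Suc (Suc l)" by (metis Suc_le_D numeral_2_eq_2 le_SucE Suc_le_mono)
  show ?R using C unfolding l by (metis le_SucI lessI less_SucI order_refl)
next
  assume ?R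
  then obtain Q0 Q1 where Q: "primeideal P R" "primeideal Q0 R" "primeideal Q1 R" "Q0 \<subset> Q1" "Q1 \<subset> P"
    by blast
  define C where "C i = (if i = 0 then Q0 else if i = 1 then Q1 else P)" for i :: nat
  have "(\<forall>i\<le>2. primeideal (C i) R) \<and> (\<forall>i<2. C i \<subset> C (Suc i)) \<and> C 2 = P"
    using Q unfolding C_def by (auto simp: less_Suc_eq numeral_2_eq_2)
  then show ?L unfolding prime_height_def
    by (intro Sup_upper) (auto simp: numeral_eq_enat)
qed

lemma mem_cgenideal_poly_ring:
  "x \<in> PIdl\<^bsub>poly_ring n\<^esub> p \<longleftrightarrow> dvd_in (polys_below (Suc n)) p x"
  by (auto simp: cgenideal_def dvd_in_def carrier_poly_ring mult.commute)

text \<open>The case \<open>p = 0\<close> supplies the zero ideal, the bottom of the chains used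
  below.\<close>

lemma primeideal_cgenideal:
  assumes "p = 0 \<or> prime_in (polys_below (Suc n)) p"
  shows "primeideal (PIdl\<^bsub>poly_ring n\<^esub> p) (poly_ring n)"
proof (rule primeidealI)
  interpret R: cring "poly_ring n" by (rule cring_poly_ring)
  show "cring (poly_ring n)" by (rule cring_poly_ring)
  have "p \<in> polys_below (Suc n)" using assms prime_inD(1) by auto
  then show "ideal (PIdl\<^bsub>poly_ring n\<^esub> p) (poly_ring n)"
    by (intro R.cgenideal_ideal) (simp add: carrier_poly_ring)
  have "\<not> dvd_in (polys_below (Suc n)) p 1"
    using assms prime_inD(3) by (auto simp: dvd_in_def)
  then show "carrier (poly_ring n) \<noteq> PIdl\<^bsub>poly_ring n\<^esub> p"
    using mem_cgenideal_poly_ring pb.one_closed carrier_poly_ring by metis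
  fix a b assume "a \<in> carrier (poly_ring n)" "b \<in> carrier (poly_ring n)"
    "a \<otimes>\<^bsub>poly_ring n\<^esub> b \<in> PIdl\<^bsub>poly_ring n\<^esub> p"
  then show "a \<in> PIdl\<^bsub>poly_ring n\<^esub> p \<or> b \<in> PIdl\<^bsub>poly_ring n\<^esub> p"
    using assms prime_inD(4)[of "polys_below (Suc n)" p a b]
    unfolding mem_cgenideal_poly_ring carrier_poly_ring by (auto simp: dvd_in_def)
qed

lemma primeideal_poly_ringD:
  assumes "primeideal P (poly_ring n)"
  shows "P \<subseteq> polys_below (Suc n)" "0 \<in> P" "1 \<notin> P"
    "\<And>a b. a \<in> polys_below (Suc n) \<Longrightarrow> b \<in> polys_below (Suc n) \<Longrightarrow> a * b \<in> P \<longleftrightarrow> a \<in> P \<or> b \<in> P"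
proof -
  interpret primeideal P "poly_ring n" by fact
  show "P \<subseteq> polys_below (Suc n)" using a_subset by (simp add: carrier_poly_ring)
  show "0 \<in> P" using additive_subgroup.zero_closed[OF is_additive_subgroup] by simp
  show "1 \<notin> P" using I_notcarr one_imp_carrier by auto
  show "a * b \<in> P \<longleftrightarrow> a \<in> P \<or> b \<in> P"
    if "a \<in> polys_below (Suc n)" "b \<in> polys_below (Suc n)" for a b
    using that I_prime[of a b] I_l_closed[of b a] I_r_closed[of a b] by (auto simp: carrier_poly_ring)
qed

text \<open>A principal prime has height one, by descent: an element of \<open>Q\<close> has the
  form p * a, and \<open>p\<close> is not in \<open>Q\<close>, so the smaller element a is again in
  \<open>Q\<close>.\<close>

lemma cgenideal_prime_minimal:
  assumes "prime_in (polys_below (Suc n)) p" "primeideal Q (poly_ring n)"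
    "Q \<subset> PIdl\<^bsub>poly_ring n\<^esub> p"
  shows "Q = {0}"
proof -
  note p = prime_inD[OF assms(1)] and Q = primeideal_poly_ringD[OF assms(2)]
  interpret Q: primeideal Q "poly_ring n" by fact
  have "p \<notin> Q"
  proof
    assume "p \<in> Q"
    then have "PIdl\<^bsub>poly_ring n\<^esub> p \<subseteq> Q"
      using Q.I_l_closed by (auto simp: cgenideal_def)
    then show False using assms(3) by blast
  qed
  have "q = 0" if "q \<in> Q" for q
    using that
  proof (induction "pb.size_in (Suc n) q" arbitrary: q rule: less_induct)
    case less
    show ?case
    proof (rule ccontr)
      assume nz: "q \<noteq> 0"
      have "dvd_in (polys_below (Suc n)) p q"
        using less.prems assms(3) mem_cgenideal_poly_ring by blast
      then obtain a where a: "a \<in> polys_below (Suc n)" "q = p * a" unfolding dvd_in_def by blast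
      then have "a \<in> Q" using Q(4)[of p a] p(1) \<open>p \<notin> Q\<close> less.prems by auto
      have "a \<noteq> 0" using nz a by auto
      then have "pb.size_in (Suc n) a < pb.size_in (Suc n) q"
        using pb.size_in_mult[of p "Suc n" a] pb.size_in_eq_0[of p "Suc n"] a p by simp
      then show False using less.hyps \<open>a \<in> Q\<close> \<open>a \<noteq> 0\<close> by blast
    qed
  qed
  then show ?thesis using Q(2) by blast
qed

text \<open>Forward, the zero ideal and every (p) must fail to contain \<open>S\<close>, since no
  chain of length two ends in them. Backward, a prime P above \<open>S\<close> has the chain {0},
  (p), P for a prime element p of P. If no prime contains \<open>S\<close>, the infimum is
  infinite.\<close>

lemma ideal_height_genideal_ge_2_iff:
  assumes S: "S \<subseteq> polys_below (Suc n)"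
  shows "2 \<le> ideal_height (poly_ring n) (Idl\<^bsub>poly_ring n\<^esub> S) \<longleftrightarrow>
    (\<exists>s\<in>S. s \<noteq> 0) \<and> (\<forall>p. prime_in (polys_below (Suc n)) p \<longrightarrow>
        (\<exists>s\<in>S. \<not> dvd_in (polys_below (Suc n)) p s))"
    (is "?L \<longleftrightarrow> ?nonzero \<and> ?coprime")
proof -
  let ?R = "poly_ring n"
  interpret R: cring ?R by (rule cring_poly_ring)
  have sub: "Idl\<^bsub>?R\<^esub> S \<subseteq> P \<longleftrightarrow> S \<subseteq> P" if "primeideal P ?R" for P
    using that S R.genideal_minimal[of P S] R.genideal_self[of S] primeideal.axioms(1)
    by (auto simp: carrier_poly_ring)
  have L: "?L \<longleftrightarrow> (\<forall>P. primeideal P ?R \<and> S \<subseteq> P \<longrightarrow>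
      (\<exists>Q0 Q1. primeideal Q0 ?R \<and> primeideal Q1 ?R \<and> Q0 \<subset> Q1 \<and> Q1 \<subset> P))"
    unfolding ideal_height_def le_INF_iff prime_height_ge_2_iff using sub by blast
  have PIdl0: "PIdl\<^bsub>?R\<^esub> 0 = {0}" using mem_cgenideal_poly_ring[of _ n 0] by (auto simp: dvd_in_def)
  have prime0: "primeideal {0} ?R" using primeideal_cgenideal[of 0 n] PIdl0 by simp
  show ?thesis
  proof (intro iffI conjI allI impI)
    assume ?L
    note chain = \<open>?L\<close>[unfolded L, rule_format]
    show ?nonzero
    proof (rule ccontr)
      assume "\<not> ?nonzero"
      then have "S \<subseteq> {0}" by blast
      then obtain Q0 Q1 where "primeideal Q1 ?R" "Q1 \<subset> {0}" using chain[of "{0}"] prime0 by blast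
      then show False using primeideal_poly_ringD(2) by blast
    qed
    fix p assume p: "prime_in (polys_below (Suc n)) p"
    show "\<exists>s\<in>S. \<not> dvd_in (polys_below (Suc n)) p s"
    proof (rule ccontr)
      assume "\<not> ?thesis"
      then have "S \<subseteq> PIdl\<^bsub>?R\<^esub> p" using mem_cgenideal_poly_ring by blast
      then obtain Q0 Q1 where Q: "primeideal Q0 ?R" "primeideal Q1 ?R" "Q0 \<subset> Q1" "Q1 \<subset> PIdl\<^bsub>?R\<^esub> p"
        using chain[of "PIdl\<^bsub>?R\<^esub> p"] primeideal_cgenideal[of p n] p by blast
      then have "Q1 = {0}" using cgenideal_prime_minimal[OF p] by blast
      then show False using Q primeideal_poly_ringD(2) by blast
    qed
  next
    assume R: "?nonzero \<and> ?coprime"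
    show ?L unfolding L
    proof (intro allI impI)
      fix P assume P: "primeideal P ?R \<and> S \<subseteq> P"
      note Pr = primeideal_poly_ringD[OF conjunct1[OF P]]
      interpret P: primeideal P ?R using P by blast
      obtain s where s: "s \<in> P" "s \<noteq> 0" using R P by blast
      \<comment> \<open>A nonzero element of a prime ideal has a prime factor in that ideal.\<close>
      have "s \<in> P \<longrightarrow> (\<exists>p\<in>P. prime_in (polys_below (Suc n)) p)"
      proof (rule pb.factorial_induct[of s "Suc n"])
        show "s \<in> polys_below (Suc n)" "s \<noteq> 0" using s Pr(1) by auto
      next
        fix u assume u: "u \<in> polys_below (Suc n)" "dvd_in (polys_below (Suc n)) u 1"
        then show "u \<in> P \<longrightarrow> (\<exists>p\<in>P. prime_in (polys_below (Suc n)) p)"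
          using Pr(3,4) unfolding dvd_in_def by metis
      next
        fix p a assume "prime_in (polys_below (Suc n)) p" "a \<in> polys_below (Suc n)"
          "a \<in> P \<longrightarrow> (\<exists>p\<in>P. prime_in (polys_below (Suc n)) p)"
        then show "p * a \<in> P \<longrightarrow> (\<exists>p\<in>P. prime_in (polys_below (Suc n)) p)"
          using Pr(4)[of p a] prime_inD(1) by blast
      qed
      then obtain p where p: "p \<in> P" "prime_in (polys_below (Suc n)) p" using s by blast
      have "PIdl\<^bsub>?R\<^esub> p \<subseteq> P" using P.I_l_closed p(1) by (auto simp: cgenideal_def)
      moreover have "PIdl\<^bsub>?R\<^esub> p \<noteq> P" using R p(2) P mem_cgenideal_poly_ring by blast
      moreover have "p \<in> PIdl\<^bsub>?R\<^esub> p" "0 \<in> PIdl\<^bsub>?R\<^esub> p" by (simp_all add: mem_cgenideal_poly_ring)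
      moreover have "primeideal (PIdl\<^bsub>?R\<^esub> p) ?R" using primeideal_cgenideal p(2) by blast
      ultimately show "\<exists>Q0 Q1. primeideal Q0 ?R \<and> primeideal Q1 ?R \<and> Q0 \<subset> Q1 \<and> Q1 \<subset> P"
        using prime0 prime_inD(2)[OF p(2)] by (intro exI[of _ "{0}"] exI[of _ "PIdl\<^bsub>?R\<^esub> p"]) blast
    qed
  qed
qed


section \<open>The map v\<close>

locale jacobian_syzygies =
  fixes n d :: nat and f :: mpoly and \<rho>s :: "mpoly vec list"
  assumes n_ge_2: "2 \<le> n" and d_pos: "0 < d"
    and f_closed: "f \<in> carrier (poly_ring n)"
    and f_homogeneous: "homogeneous (int d) f"
    and f_square_free: "square_free (poly_ring n) f"
    and length_\<rho>s: "length \<rho>s = n - 1"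
    and \<rho>s_syzygies: "set \<rho>s \<subseteq> syzygies n f"
begin

abbreviation S :: "mpoly set" where "S \<equiv> polys_below (Suc n)"

definition minor :: "nat set \<Rightarrow> mpoly" where
  "minor J = det (submatrix (mat_of_rows (n + 1) \<rho>s) UNIV J)"

section \<open>Square-freeness and divisibility by f\<close>

lemma f_in_S: "f \<in> S"
  using f_closed by (simp add: carrier_poly_ring)

lemma not_prime_square_dvd_f:
  assumes "prime_in S p"
  shows "\<not> dvd_in S (p * p) f"
proof
  assume "dvd_in S (p * p) f"
  then have "p \<in> Units (poly_ring n)"
    using f_square_free prime_inD(1)[OF assms]
    by (auto simp: square_free_def carrier_poly_ring factor_def dvd_in_def)
  then have "dvd_in S p 1"
    by (auto simp: Units_def carrier_poly_ring dvd_in_def)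
  then show False using prime_inD(3)[OF assms] by blast
qed

lemma f_nonzero: "f \<noteq> 0"
proof
  assume "f = 0"
  then have "0 \<in> Units (poly_ring n)"
    using f_square_free pb.zero_closed[of "Suc n"]
    by (auto simp: square_free_def carrier_poly_ring factor_def)
  then show False by (auto simp: Units_def)
qed

text \<open>By the product rule f_k is congruent to p_k * h modulo p. Square-freeness keeps
  \<open>p\<close> from dividing \<open>h\<close>, and for some k it does not divide p_k.\<close>

lemma prime_factor_not_dvd_gradient:
  assumes "prime_in S p" "h \<in> S" "f = p * h"
  shows "\<exists>k\<le>n. \<not> dvd_in S p (partial_deriv k f)"
proof -
  note p = prime_inD[OF assms(1)]
  obtain k where k: "k < Suc n" "\<not> dvd_in S p (partial_deriv k p)"
    using not_dvd_partial_deriv[OF p(1,2,3)] by blast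
  have "\<not> dvd_in S p h"
    using not_prime_square_dvd_f[OF assms(1)] assms(3) by (auto simp: dvd_in_def mult.assoc)
  then have "\<not> dvd_in S p (partial_deriv k p * h)"
    using k(2) p(4) partial_deriv_closed[OF p(1)] assms(2) by blast
  moreover have "partial_deriv k p * h = partial_deriv k f - p * partial_deriv k h"
    unfolding assms(3) by (simp add: partial_deriv_mult)
  moreover have "dvd_in S p (p * partial_deriv k h)"
    using partial_deriv_closed[OF assms(2)] by (auto simp: dvd_in_def)
  ultimately have "\<not> dvd_in S p (partial_deriv k f)" by (metis pb.dvd_in_diff)
  then show ?thesis using k(1) less_Suc_eq_le by blast
qed

text \<open>The prime factors of \<open>f\<close> are collected into a divisor h of
  \<open>D\<close>. Once D = a * E, cancelling a leaves p dividing f_k * E; for a k with p not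
  dividing f_k, it divides \<open>E\<close>.\<close>

lemma f_dvd_of_gradient:
  assumes D: "D \<in> S" "\<And>k. k \<le> n \<Longrightarrow> dvd_in S f (partial_deriv k f * D)"
  shows "dvd_in S f D"
proof -
  \<comment> \<open>The complementary factor \<open>g\<close> is quantified inside, because it grows
    by \<open>p\<close> when the hypothesis is used for \<open>a\<close>.\<close>
  have "\<forall>g\<in>S. f = h * g \<longrightarrow> dvd_in S h D" if "h \<in> S" "h \<noteq> 0" for h
    using that
  proof (induction rule: pb.factorial_induct)
    case (unit u)
    then show ?case using D(1) pb.unit_dvd_in by blast
  next
    case (prime p a)
    note p = prime_inD[OF prime.hyps(1)]
    show ?case
    proof (intro ballI impI)
      fix g assume g: "g \<in> S" "f = p * a * g"
      then have f: "f = a * (p * g)" "f = p * (a * g)" by (simp_all add: ac_simps)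
      then have "dvd_in S a D" using prime g(1) p(1) by blast
      then obtain E where E: "E \<in> S" "D = a * E" unfolding dvd_in_def by blast
      obtain k where k: "k \<le> n" "\<not> dvd_in S p (partial_deriv k f)"
        using prime_factor_not_dvd_gradient[OF prime.hyps(1) _ f(2)] g(1) prime.hyps(2) by blast
      obtain w where w: "w \<in> S" "partial_deriv k f * D = f * w"
        using D(2)[OF k(1)] unfolding dvd_in_def by blast
      then have "a * (partial_deriv k f * E) = a * (p * (g * w))"
        unfolding E(2) f(1) by (simp add: ac_simps)
      then have "partial_deriv k f * E = p * (g * w)" using prime.hyps(3) mult_left_cancel by blast
      then have "dvd_in S p (partial_deriv k f * E)"
        using g(1) w(1) unfolding dvd_in_def by blast
      then have "dvd_in S p E"
        using p(4) k(2) E(1) partial_deriv_closed[OF f_in_S] by blast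
      then show "dvd_in S (p * a) D"
        unfolding E(2) mult.commute[of p a] using pb.dvd_in_cancel[OF prime.hyps(3)] by blast
    qed
  qed
  then show ?thesis using f_in_S f_nonzero by (metis mult_1_right pb.one_closed)
qed

section \<open>Linearity of u and v on syzygies\<close>

lemma syzygies_iff:
  "\<rho> \<in> syzygies n f \<longleftrightarrow> \<rho> \<in> carrier_vec (Suc n) \<and> (\<forall>j\<le>n. \<rho> $ j \<in> S) \<and>
     (\<Sum>j\<le>n. \<rho> $ j * partial_deriv j f) = 0"
  by (simp add: syzygies_def carrier_poly_ring)

lemma nth_\<rho>s_syzygy: "i < n - 1 \<Longrightarrow> \<rho>s ! i \<in> syzygies n f"
  using \<rho>s_syzygies length_\<rho>s by (metis nth_mem subsetD)

lemma nth_\<rho>s_closed: "i < n - 1 \<Longrightarrow> j \<le> n \<Longrightarrow> \<rho>s ! i $ j \<in> S"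
  using nth_\<rho>s_syzygy by (simp add: syzygies_iff)

lemma syzygy_add:
  assumes "\<rho> \<in> syzygies n f" "\<sigma> \<in> syzygies n f"
  shows "\<rho> + \<sigma> \<in> syzygies n f"
proof -
  have "(\<rho> + \<sigma>) $ j = \<rho> $ j + \<sigma> $ j" if "j \<le> n" for j
    using that assms by (auto simp: syzygies_iff)
  then show ?thesis
    using assms by (simp add: syzygies_iff distrib_right sum.distrib)
qed

lemma syzygy_smult:
  assumes "a \<in> S" "\<rho> \<in> syzygies n f"
  shows "a \<cdot>\<^sub>v \<rho> \<in> syzygies n f"
proof -
  have "(a \<cdot>\<^sub>v \<rho>) $ j = a * \<rho> $ j" if "j \<le> n" for j
    using that assms by (auto simp: syzygies_iff)
  then show ?thesis
    using assms by (simp add: syzygies_iff mult.assoc flip: sum_distrib_left)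
qed

lemma syz_u_index: "j \<le> n \<Longrightarrow> syz_u n \<rho>s a $ j = (\<Sum>i<n - 1. a $ i * \<rho>s ! i $ j)"
  by (simp add: syz_u_def length_\<rho>s)

lemma syz_u_carrier: "syz_u n \<rho>s a \<in> carrier_vec (Suc n)"
  by (simp add: syz_u_def)

lemma syz_u_syzygy:
  assumes "\<And>i. i < n - 1 \<Longrightarrow> a $ i \<in> S"
  shows "syz_u n \<rho>s a \<in> syzygies n f"
proof -
  have "(\<Sum>j\<le>n. syz_u n \<rho>s a $ j * partial_deriv j f) =
      (\<Sum>i<n - 1. a $ i * (\<Sum>j\<le>n. \<rho>s ! i $ j * partial_deriv j f))"
    unfolding sum_distrib_left by (subst sum.swap) (simp add: syz_u_index sum_distrib_right mult.assoc)
  also have "\<dots> = 0" using nth_\<rho>s_syzygy by (simp add: syzygies_iff)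
  finally show ?thesis
    using assms nth_\<rho>s_closed
    by (auto simp: syzygies_iff syz_u_carrier syz_u_index intro!: pb.sum_closed)
qed

lemma syz_matrix_carrier: "syz_matrix n \<rho>s \<rho> \<in> carrier_mat (Suc n) (Suc n)"
  using n_ge_2 by (auto simp: syz_matrix_def length_\<rho>s intro!: carrier_matI)

lemma syz_matrix_index:
  assumes "j \<le> n"
  shows "syz_matrix n \<rho>s \<rho> $$ (0, j) = Var j"
    "i < n \<Longrightarrow> syz_matrix n \<rho>s \<rho> $$ (Suc i, j) = (\<rho>s @ [\<rho>]) ! i $ j"
    "syz_matrix n \<rho>s \<rho> $$ (n, j) = \<rho> $ j"
proof -
  obtain m where "n = Suc m" using n_ge_2 by (cases n) auto
  then show "syz_matrix n \<rho>s \<rho> $$ (0, j) = Var j"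
    "i < n \<Longrightarrow> syz_matrix n \<rho>s \<rho> $$ (Suc i, j) = (\<rho>s @ [\<rho>]) ! i $ j"
    "syz_matrix n \<rho>s \<rho> $$ (n, j) = \<rho> $ j"
    using assms length_\<rho>s by (simp_all add: syz_matrix_def mat_of_rows_index nth_append)
qed

lemma syz_matrix_row_syzygy:
  assumes "\<rho> \<in> syzygies n f" "i < n"
  shows "(\<rho>s @ [\<rho>]) ! i \<in> syzygies n f"
  using assms \<rho>s_syzygies length_\<rho>s by (auto simp: nth_append intro: nth_\<rho>s_syzygy)

lemma syz_matrix_closed:
  assumes "\<rho> \<in> syzygies n f" "i < Suc n" "j < Suc n"
  shows "syz_matrix n \<rho>s \<rho> $$ (i, j) \<in> S"
  using assms syz_matrix_row_syzygy[OF assms(1)]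
  by (cases i) (auto simp: syz_matrix_index Var_in_polys_below syzygies_iff)

text \<open>Row 0 gives Euler's identity; all other rows are syzygies and annihilate the
  gradient.\<close>

lemma syz_matrix_gradient:
  assumes "\<rho> \<in> syzygies n f" "i < Suc n"
  shows "(\<Sum>j<Suc n. syz_matrix n \<rho>s \<rho> $$ (i, j) * partial_deriv j f) =
    (if i = 0 then of_nat d * f else 0)"
  using assms syz_matrix_row_syzygy[OF assms(1)] euler_identity[OF f_in_S f_homogeneous]
  by (cases i) (auto simp: lessThan_Suc_atMost syz_matrix_index syzygies_iff cong: sum.cong_simp)

lemma det_syz_matrix_closed: "\<rho> \<in> syzygies n f \<Longrightarrow> det (syz_matrix n \<rho>s \<rho>) \<in> S"
  by (rule pb.det_closed[OF syz_matrix_carrier syz_matrix_closed])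

lemma det_syz_matrix_gradient:
  assumes "\<rho> \<in> syzygies n f" "k \<le> n"
  shows "det (syz_matrix n \<rho>s \<rho>) * partial_deriv k f =
    cofactor (syz_matrix n \<rho>s \<rho>) 0 k * (of_nat d * f)"
  by (rule det_mult_row_kernel[OF syz_matrix_carrier]) (use assms syz_matrix_gradient in auto)

lemma f_dvd_det_syz_matrix:
  assumes "\<rho> \<in> syzygies n f"
  shows "dvd_in S f (det (syz_matrix n \<rho>s \<rho>))"
proof (rule f_dvd_of_gradient)
  fix k assume k: "k \<le> n"
  have "cofactor (syz_matrix n \<rho>s \<rho>) 0 k \<in> S"
    by (rule pb.cofactor_closed[OF syz_matrix_carrier syz_matrix_closed]) (use assms k in auto)
  then show "dvd_in S f (partial_deriv k f * det (syz_matrix n \<rho>s \<rho>))"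
    using det_syz_matrix_gradient[OF assms k]
    by (auto simp: dvd_in_def ac_simps intro!: bexI[of _ "of_nat d * cofactor (syz_matrix n \<rho>s \<rho>) 0 k"])
qed (rule det_syz_matrix_closed[OF assms])

text \<open>Shows that the definite description in \<open>syz_v\<close> denotes; afterwards
  \<open>v\<close> is handled only through this equation, by cancelling \<open>f\<close>.\<close>

lemma det_syz_matrix_eq_syz_v:
  assumes "\<rho> \<in> syzygies n f"
  shows "syz_v n f \<rho>s \<rho> \<in> S" "det (syz_matrix n \<rho>s \<rho>) = syz_v n f \<rho>s \<rho> * f"
proof -
  obtain q where q: "q \<in> S" "det (syz_matrix n \<rho>s \<rho>) = q * f"
    using f_dvd_det_syz_matrix[OF assms] by (auto simp: dvd_in_def mult.commute)
  then have "syz_v n f \<rho>s \<rho> = q"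
    unfolding syz_v_def carrier_poly_ring using f_nonzero by (intro the_equality) auto
  then show "syz_v n f \<rho>s \<rho> \<in> S" "det (syz_matrix n \<rho>s \<rho>) = syz_v n f \<rho>s \<rho> * f"
    using q by auto
qed

text \<open>The cofactors of the last row do not involve that row, so the zero vector can stand in
  for it. This makes the determinant visibly linear in \<open>\<rho>\<close>.\<close>

lemma det_syz_matrix_last_row:
  "det (syz_matrix n \<rho>s \<rho>) = (\<Sum>j<Suc n. \<rho> $ j * cofactor (syz_matrix n \<rho>s (0\<^sub>v (n + 1))) n j)"
proof -
  have "mat_delete (syz_matrix n \<rho>s \<rho>) n j = mat_delete (syz_matrix n \<rho>s (0\<^sub>v (n + 1))) n j" for j
  proof (rule eq_matI)
    fix a b assume "a < dim_row (mat_delete (syz_matrix n \<rho>s (0\<^sub>v (n + 1))) n j)"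
      "b < dim_col (mat_delete (syz_matrix n \<rho>s (0\<^sub>v (n + 1))) n j)"
    then have ab: "a < n" "b < n" using syz_matrix_carrier[of "0\<^sub>v (n + 1)"] by (auto simp: mat_delete_def)
    have "syz_matrix n \<rho>s \<rho> $$ (a, c) = syz_matrix n \<rho>s (0\<^sub>v (n + 1)) $$ (a, c)" if "c \<le> n" for c
      using ab that length_\<rho>s by (cases a) (auto simp: syz_matrix_index nth_append)
    then show "mat_delete (syz_matrix n \<rho>s \<rho>) n j $$ (a, b) =
        mat_delete (syz_matrix n \<rho>s (0\<^sub>v (n + 1))) n j $$ (a, b)"
      using ab syz_matrix_carrier[of "0\<^sub>v (n + 1)"] syz_matrix_carrier[of \<rho>]
      by (auto simp: mat_delete_def)
  qed (use syz_matrix_carrier[of "0\<^sub>v (n + 1)"] syz_matrix_carrier[of \<rho>] in \<open>auto simp: mat_delete_def\<close>)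
  then have "cofactor (syz_matrix n \<rho>s \<rho>) n j = cofactor (syz_matrix n \<rho>s (0\<^sub>v (n + 1))) n j" for j
    by (simp add: cofactor_def)
  then show ?thesis
    by (subst laplace_expansion_row[OF syz_matrix_carrier, of n])
      (auto simp: syz_matrix_index less_Suc_eq_le intro!: sum.cong)
qed

lemma syz_v_add:
  assumes "\<rho> \<in> syzygies n f" "\<sigma> \<in> syzygies n f"
  shows "syz_v n f \<rho>s (\<rho> + \<sigma>) = syz_v n f \<rho>s \<rho> + syz_v n f \<rho>s \<sigma>"
proof -
  have "det (syz_matrix n \<rho>s (\<rho> + \<sigma>)) = det (syz_matrix n \<rho>s \<rho>) + det (syz_matrix n \<rho>s \<sigma>)"
    unfolding det_syz_matrix_last_row sum.distrib[symmetric]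
    using assms by (intro sum.cong) (auto simp: syzygies_iff distrib_right)
  then have "syz_v n f \<rho>s (\<rho> + \<sigma>) * f = (syz_v n f \<rho>s \<rho> + syz_v n f \<rho>s \<sigma>) * f"
    using det_syz_matrix_eq_syz_v(2) assms syzygy_add by (simp add: distrib_right)
  then show ?thesis using f_nonzero by simp
qed

lemma syz_v_smult:
  assumes "a \<in> S" "\<rho> \<in> syzygies n f"
  shows "syz_v n f \<rho>s (a \<cdot>\<^sub>v \<rho>) = a * syz_v n f \<rho>s \<rho>"
proof -
  have "det (syz_matrix n \<rho>s (a \<cdot>\<^sub>v \<rho>)) = a * det (syz_matrix n \<rho>s \<rho>)"
    unfolding det_syz_matrix_last_row sum_distrib_left
    using assms by (intro sum.cong) (auto simp: syzygies_iff mult.assoc)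
  then have "syz_v n f \<rho>s (a \<cdot>\<^sub>v \<rho>) * f = (a * syz_v n f \<rho>s \<rho>) * f"
    using det_syz_matrix_eq_syz_v(2)[OF syzygy_smult[OF assms]] det_syz_matrix_eq_syz_v(2)[OF assms(2)] by (simp add: mult.assoc)
  then show ?thesis using f_nonzero by simp
qed

text \<open>By linearity it suffices to take one of the given syzygies as last row, and then two
  rows coincide.\<close>

lemma syz_v_syz_u:
  assumes "\<And>i. i < n - 1 \<Longrightarrow> a $ i \<in> S"
  shows "syz_v n f \<rho>s (syz_u n \<rho>s a) = 0"
proof -
  have "det (syz_matrix n \<rho>s (\<rho>s ! i)) = 0" if "i < n - 1" for i
  proof (rule det_identical_rows[OF syz_matrix_carrier, of "Suc i" n])
    show "row (syz_matrix n \<rho>s (\<rho>s ! i)) (Suc i) = row (syz_matrix n \<rho>s (\<rho>s ! i)) n"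
      using that syz_matrix_carrier[of "\<rho>s ! i"] length_\<rho>s
      by (intro eq_vecI) (auto simp: syz_matrix_index nth_append)
  qed (use that in auto)
  moreover have "det (syz_matrix n \<rho>s (syz_u n \<rho>s a)) =
      (\<Sum>i<n - 1. a $ i * det (syz_matrix n \<rho>s (\<rho>s ! i)))"
    unfolding det_syz_matrix_last_row sum_distrib_left
    by (subst sum.swap) (simp add: syz_u_index sum_distrib_right mult.assoc less_Suc_eq_le cong: sum.cong_simp)
  ultimately have "det (syz_matrix n \<rho>s (syz_u n \<rho>s a)) = 0" by simp
  then show ?thesis using det_syz_matrix_eq_syz_v(2)[OF syz_u_syzygy[OF assms]] f_nonzero by simp
qed


section \<open>Exactness\<close>

definition coefficient_vecs :: "mpoly vec set" where
  "coefficient_vecs = {a \<in> carrier_vec (n - 1). \<forall>i<n - 1. a $ i \<in> S}"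

lemma carrier_direct_sum:
  "carrier (direct_sum (n - 1) (\<lambda>j. shift (poly_module n) (k j))) = coefficient_vecs"
  by (auto simp: direct_sum_def shift_def poly_module_def coefficient_vecs_def carrier_poly_ring)

lemma vec_coefficient_vecs: "(\<And>i. i < n - 1 \<Longrightarrow> c i \<in> S) \<Longrightarrow> vec (n - 1) c \<in> coefficient_vecs"
  by (simp add: coefficient_vecs_def)

lemma syz_u_eq_iff:
  assumes "\<rho> \<in> carrier_vec (Suc n)"
  shows "syz_u n \<rho>s a = \<rho> \<longleftrightarrow> (\<forall>j\<le>n. (\<Sum>i<n - 1. a $ i * \<rho>s ! i $ j) = \<rho> $ j)"
  using assms syz_u_carrier[of a] by (auto simp: vec_eq_iff less_Suc_eq_le syz_u_index)

lemma graded_hom_syz_u: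
  assumes "\<And>i. i < n - 1 \<Longrightarrow> homogeneous_vec (int (ds ! i)) (\<rho>s ! i)"
  shows "graded_hom (poly_ring n)
    (direct_sum (n - 1) (\<lambda>j. shift (poly_module n) (- int (ds ! j))))
    (syzygy_module n f) (syz_u n \<rho>s)"
    (is "graded_hom _ ?L ?M _")
  unfolding graded_hom_def carrier_direct_sum
proof (intro conjI ballI allI subsetI funcsetI)
  fix a assume "a \<in> coefficient_vecs"
  then show "syz_u n \<rho>s a \<in> carrier ?M"
    using syz_u_syzygy by (simp add: syzygy_module_def coefficient_vecs_def)
next
  fix a b assume "a \<in> coefficient_vecs" "b \<in> coefficient_vecs"
  have "syz_u n \<rho>s (vec (n - 1) (\<lambda>i. a $ i + b $ i)) = syz_u n \<rho>s a + syz_u n \<rho>s b"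
    using syz_u_carrier[of a] syz_u_carrier[of b]
    by (subst syz_u_eq_iff) (auto simp: syz_u_index distrib_right sum.distrib)
  then show "syz_u n \<rho>s (a \<oplus>\<^bsub>?L\<^esub> b) = syz_u n \<rho>s a \<oplus>\<^bsub>?M\<^esub> syz_u n \<rho>s b"
    by (simp add: direct_sum_def shift_def poly_module_def syzygy_module_def)
next
  fix c a assume "c \<in> carrier (poly_ring n)" "a \<in> coefficient_vecs"
  have "syz_u n \<rho>s (vec (n - 1) (\<lambda>i. c * a $ i)) = c \<cdot>\<^sub>v syz_u n \<rho>s a"
    using syz_u_carrier[of a]
    by (subst syz_u_eq_iff) (auto simp: syz_u_index sum_distrib_left mult.assoc)
  then show "syz_u n \<rho>s (c \<odot>\<^bsub>?L\<^esub> a) = c \<odot>\<^bsub>?M\<^esub> syz_u n \<rho>s a"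
    by (simp add: direct_sum_def shift_def poly_module_def syzygy_module_def)
next
  fix k \<rho> assume "\<rho> \<in> syz_u n \<rho>s ` hcomp ?L k"
  then obtain a where a: "\<rho> = syz_u n \<rho>s a" "a \<in> coefficient_vecs"
    "\<And>i. i < n - 1 \<Longrightarrow> homogeneous (- int (ds ! i) + k) (a $ i)"
    by (auto simp: direct_sum_def shift_def poly_module_def coefficient_vecs_def carrier_poly_ring)
  have "homogeneous k (\<rho> $ j)" if j: "j \<le> n" for j
    unfolding a(1) syz_u_index[OF j]
  proof (rule homogeneous_sum)
    fix i assume "i \<in> {..<n - 1}"
    then have i: "i < n - 1" by simp
    have "homogeneous (int (ds ! i)) (\<rho>s ! i $ j)"
      using assms[OF i] nth_\<rho>s_syzygy[OF i] j by (auto simp: homogeneous_vec_def syzygies_iff)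
    from homogeneous_mult[OF a(3)[OF i] this] show "homogeneous k (a $ i * \<rho>s ! i $ j)" by simp
  qed
  moreover have "\<rho> \<in> syzygies n f" using a syz_u_syzygy by (simp add: coefficient_vecs_def)
  ultimately show "\<rho> \<in> hcomp ?M k"
    by (auto simp: syzygy_module_def homogeneous_vec_def syzygies_iff)
qed

text \<open>Every Leibniz term takes one entry from each row, and each row is homogeneous, so all
  terms have the sum of the row degrees as degree.\<close>

lemma homogeneous_det_syz_matrix:
  assumes "length ds = n - 1" "\<And>i. i < n - 1 \<Longrightarrow> homogeneous_vec (int (ds ! i)) (\<rho>s ! i)"
    and "\<rho> \<in> syzygies n f" "homogeneous_vec k \<rho>"
  shows "homogeneous (1 + int (sum_list ds) + k) (det (syz_matrix n \<rho>s \<rho>))"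
proof -
  \<comment> \<open>The row degrees: 1 for the row of variables, then those of the given syzygies,
    then that of \<open>\<rho>\<close>.\<close>
  define es where "es = 1 # map int ds @ [k]"
  have len: "length es = Suc n" using n_ge_2 assms(1) by (simp add: es_def)
  have entry: "homogeneous (es ! i) (syz_matrix n \<rho>s \<rho> $$ (i, j))" if "i < Suc n" "j < Suc n" for i j
  proof (cases i)
    case 0
    then show ?thesis using that by (simp add: es_def syz_matrix_index homogeneous_Var)
  next
    case (Suc l)
    have "homogeneous_vec ((map int ds @ [k]) ! l) ((\<rho>s @ [\<rho>]) ! l)"
    proof (cases "l < n - 1")
      case True
      then show ?thesis using assms(1,2) length_\<rho>s by (simp add: nth_append)
    next
      case False
      then have "l = n - 1" using Suc that by simp
      then show ?thesis using assms(1,4) length_\<rho>s by (simp add: nth_append)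
    qed
    moreover have "(\<rho>s @ [\<rho>]) ! l \<in> syzygies n f"
      using syz_matrix_row_syzygy[OF assms(3)] Suc that by simp
    ultimately show ?thesis
      using Suc that by (auto simp: es_def syz_matrix_index homogeneous_vec_def syzygies_iff)
  qed
  have sign: "homogeneous 0 (signof p :: mpoly)" for p :: "nat \<Rightarrow> nat"
    using homogeneous_one homogeneous_uminus[OF homogeneous_one] by (simp add: sign_def)
  have "homogeneous (0 + (\<Sum>i = 0..<Suc n. es ! i)) (det (syz_matrix n \<rho>s \<rho>))"
    unfolding det_def'[OF syz_matrix_carrier]
  proof (intro homogeneous_sum homogeneous_mult sign homogeneous_prod)
    fix p i assume "p \<in> {p. p permutes {0..<Suc n}}" and i: "i \<in> {0..<Suc n}"
    then have "p i < Suc n" using permutes_in_image[of p "{0..<Suc n}" i] by simp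
    then show "homogeneous (es ! i) (syz_matrix n \<rho>s \<rho> $$ (i, p i))" using entry i by simp
  qed
  also have "(\<Sum>i = 0..<Suc n. es ! i) = sum_list es"
    unfolding len[symmetric] by (simp add: sum_list_sum_nth)
  also have "0 + sum_list es = 1 + int (sum_list ds) + k"
  proof -
    have "int (sum_list xs) = sum_list (map int xs)" for xs by (induction xs) auto
    then show ?thesis by (simp add: es_def)
  qed
  finally show ?thesis .
qed

text \<open>The shift is the degree of the determinant minus the degree \<open>d\<close> of the
  divisor \<open>f\<close>.\<close>

lemma graded_hom_syz_v:
  assumes "length ds = n - 1" "\<And>i. i < n - 1 \<Longrightarrow> homogeneous_vec (int (ds ! i)) (\<rho>s ! i)"
  shows "graded_hom (poly_ring n) (syzygy_module n f)
    (shift (bourbaki_module n f \<rho>s) (int (sum_list ds) - int d + 1)) (syz_v n f \<rho>s)"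
    (is "graded_hom _ ?M ?N _")
  unfolding graded_hom_def
proof (intro conjI ballI allI subsetI funcsetI)
  fix k q assume "q \<in> syz_v n f \<rho>s ` hcomp ?M k"
  then obtain \<rho> where \<rho>: "\<rho> \<in> syzygies n f" "homogeneous_vec k \<rho>" "q = syz_v n f \<rho>s \<rho>"
    by (auto simp: syzygy_module_def)
  have "homogeneous (1 + int (sum_list ds) + k) (syz_v n f \<rho>s \<rho> * f)"
    using homogeneous_det_syz_matrix[OF assms \<rho>(1,2)] det_syz_matrix_eq_syz_v(2)[OF \<rho>(1)] by simp
  from homogeneous_dividend[OF this f_homogeneous f_nonzero]
  have "homogeneous (int (sum_list ds) - int d + 1 + k) q"
    unfolding \<rho>(3) by (simp add: algebra_simps)
  then show "q \<in> hcomp ?N k"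
    using \<rho> by (auto simp: shift_def bourbaki_module_def bourbaki_ideal_def)
qed (auto simp: shift_def bourbaki_module_def bourbaki_ideal_def syzygy_module_def
    carrier_poly_ring syz_v_add syz_v_smult)

text \<open>Gradedness holds for both maps, surjectivity onto the Bourbaki ideal is its definition,
  and v after u is zero. What remains is injectivity of u and that u fills the kernel of v.\<close>

lemma graded_short_exact_iff:
  assumes "length ds = n - 1" "\<forall>i<n - 1. homogeneous_vec (int (ds ! i)) (\<rho>s ! i)"
  shows "graded_short_exact (poly_ring n)
      (direct_sum (n - 1) (\<lambda>j. shift (poly_module n) (- int (ds ! j))))
      (syz_u n \<rho>s) (syzygy_module n f) (syz_v n f \<rho>s)
      (shift (bourbaki_module n f \<rho>s) (int (sum_list ds) - int d + 1)) \<longleftrightarrow>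
    inj_on (syz_u n \<rho>s) coefficient_vecs \<and>
    (\<forall>\<rho>\<in>syzygies n f. syz_v n f \<rho>s \<rho> = 0 \<longrightarrow> \<rho> \<in> syz_u n \<rho>s ` coefficient_vecs)"
proof -
  have "carrier (syzygy_module n f) = syzygies n f"
    "carrier (shift (bourbaki_module n f \<rho>s) l) = syz_v n f \<rho>s ` syzygies n f"
    "\<zero>\<^bsub>shift (bourbaki_module n f \<rho>s) l\<^esub> = 0" for l
    by (simp_all add: syzygy_module_def shift_def bourbaki_module_def bourbaki_ideal_def)
  moreover have "syz_u n \<rho>s ` coefficient_vecs \<subseteq> {\<rho> \<in> syzygies n f. syz_v n f \<rho>s \<rho> = 0}"
    using syz_u_syzygy syz_v_syz_u by (auto simp: coefficient_vecs_def)
  ultimately show ?thesis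
    unfolding graded_short_exact_def carrier_direct_sum
    using graded_hom_syz_u[of ds] graded_hom_syz_v[of ds] assms by auto
qed

section \<open>Maximal minors of the given syzygies\<close>

lemma minor_eq:
  assumes "J \<subseteq> {..n}" "card J = n - 1"
  shows "minor J = det (mat (n - 1) (n - 1) (\<lambda>(a, b). \<rho>s ! a $ pick J b))"
  using submatrix_rows[of J n \<rho>s] assms length_\<rho>s by (simp add: minor_def)

lemma pick_le_n:
  assumes "J \<subseteq> {..n}" "card J = n - 1" "b < n - 1"
  shows "pick J b \<le> n"
  using pick_in_set_le[of b J] assms by auto

lemma minor_closed:
  assumes "J \<subseteq> {..n}" "card J = n - 1"
  shows "minor J \<in> S"
  unfolding minor_eq[OF assms]
  by (rule pb.det_closed[of _ "n - 1"]) (use nth_\<rho>s_closed pick_le_n[OF assms] in auto)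

text \<open>The difference of the two coefficient vectors lies in the kernel of the transposed
  submatrix on the columns \<open>J\<close>, whose determinant is nonzero in a domain.\<close>

lemma independent_of_minor:
  assumes J: "J \<subseteq> {..n}" "card J = n - 1" "minor J \<noteq> 0"
    and eq: "\<And>j. j \<le> n \<Longrightarrow> (\<Sum>i<n - 1. b i * \<rho>s ! i $ j) = (\<Sum>i<n - 1. c i * \<rho>s ! i $ j)"
    and "i < n - 1"
  shows "b i = c i"
proof (rule ccontr)
  let ?B = "mat (n - 1) (n - 1) (\<lambda>(a, b). \<rho>s ! a $ pick J b)"
  define w where "w = vec (n - 1) (\<lambda>i. b i - c i)"
  assume "b i \<noteq> c i"
  then have "w $ i \<noteq> 0" using assms(5) by (simp add: w_def)
  then have "w \<noteq> 0\<^sub>v (n - 1)" using assms(5) by auto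
  moreover have "?B\<^sup>T *\<^sub>v w = 0\<^sub>v (n - 1)"
  proof (rule eq_vecI)
    fix k assume "k < dim_vec (0\<^sub>v (n - 1) :: mpoly vec)"
    then have k: "k < n - 1" by simp
    have "(?B\<^sup>T *\<^sub>v w) $ k = (\<Sum>i<n - 1. \<rho>s ! i $ pick J k * (b i - c i))"
      using k by (simp add: w_def scalar_prod_def atLeast0LessThan)
    also have "\<dots> = (\<Sum>i<n - 1. b i * \<rho>s ! i $ pick J k) - (\<Sum>i<n - 1. c i * \<rho>s ! i $ pick J k)"
      by (simp add: sum_subtractf algebra_simps)
    also have "\<dots> = 0" using eq[OF pick_le_n[OF J(1,2) k]] by simp
    finally show "(?B\<^sup>T *\<^sub>v w) $ k = 0\<^sub>v (n - 1) $ k" using k by simp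
  qed simp
  moreover have "w \<in> carrier_vec (n - 1)" by (simp add: w_def)
  ultimately have "det ?B\<^sup>T = 0"
    using det_0_iff_vec_prod_zero[of "?B\<^sup>T" "n - 1"] by auto
  then show False using J(3) det_transpose[of ?B "n - 1"] minor_eq[OF J(1,2)] by simp
qed

text \<open>Border the minor on \<open>J\<close> by the row \<open>\<rho>\<close> and the column
  \<open>j\<close>. The resulting determinant vanishes; expanded along column \<open>j\<close>, it
  has \<open>minor J\<close> as coefficient of \<open>\<rho> $ j\<close>, and the other coefficients
  do not depend on \<open>j\<close>.\<close>

lemma minor_mult_kernel:
  assumes \<rho>: "\<rho> \<in> syzygies n f" "syz_v n f \<rho>s \<rho> = 0"
    and J: "J \<subseteq> {..n}" "card J = n - 1"
  shows "\<exists>e. (\<forall>i<n - 1. e i \<in> S) \<and> (\<forall>j\<le>n. minor J * \<rho> $ j = (\<Sum>i<n - 1. e i * \<rho>s ! i $ j))"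
proof -
  let ?B = "syz_matrix n \<rho>s \<rho>"
  define t where "t = n - 1"
  have n: "n = Suc t" using n_ge_2 by (simp add: t_def)
  have "det ?B = 0" using det_syz_matrix_eq_syz_v(2)[OF \<rho>(1)] \<rho>(2) by simp
  then have cof: "cofactor ?B 0 k = 0" if "k \<le> n" for k
    \<comment> \<open>Cancelling needs d * f to be nonzero, which again uses characteristic
      zero.\<close>
    using det_syz_matrix_gradient[OF \<rho>(1) that] f_nonzero d_pos by simp
  \<comment> \<open>\<open>M\<close> is the syzygy matrix without its row of variables: rows below
    \<open>t\<close> are the given syzygies, and row \<open>t\<close> is
    \<open>\<rho>\<close>.\<close>
  define M where "M a j = ?B $$ (Suc a, j)" for a j
  define s where "s = pick J"
  define D where "D i = cofactor (mat (Suc t) (Suc t) (\<lambda>(a, b). M a ((s(t := 0)) b))) i t" for i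
  have M: "M i j = \<rho>s ! i $ j" if "i < t" "j \<le> n" for i j
    using that length_\<rho>s by (simp add: M_def syz_matrix_index(2) t_def nth_append)
  have M_last: "M t j = \<rho> $ j" if "j \<le> n" for j
    using that by (simp add: M_def syz_matrix_index(3) flip: n)
  have s: "s b \<le> n" if "b < t" for b
    using pick_le_n[OF J] that by (simp add: s_def t_def)
  have "D i \<in> S" if "i \<le> t" for i
    unfolding D_def
  proof (rule pb.cofactor_closed[of _ "Suc t"])
    fix a b assume "a < Suc t" "b < Suc t"
    moreover have "(s(t := 0)) b \<le> n" using s[of b] \<open>b < Suc t\<close> by simp
    ultimately show "mat (Suc t) (Suc t) (\<lambda>(a, b). M a ((s(t := 0)) b)) $$ (a, b) \<in> S"
      using syz_matrix_closed[OF \<rho>(1)] by (simp add: M_def n del: fun_upd_apply)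
  qed (use that in auto)
  moreover have "minor J * \<rho> $ j = (\<Sum>i<n - 1. - D i * \<rho>s ! i $ j)" if j: "j \<le> n" for j
  proof -
    have corner: "D t = minor J"
    proof -
      have "D t = det (mat t t (\<lambda>(a, b). M a (s b)))"
        unfolding D_def cofactor_last_column by (rule cofactor_corner)
      also have "mat t t (\<lambda>(a, b). M a (s b)) = mat (n - 1) (n - 1) (\<lambda>(a, b). \<rho>s ! a $ pick J b)"
        unfolding t_def[symmetric] using M s by (intro eq_matI) (auto simp: s_def)
      finally show ?thesis using minor_eq[OF J] by simp
    qed
    \<comment> \<open>For \<open>j\<close> in \<open>J\<close> this matrix has a repeated column;
      the vanishing result covers such choices too.\<close>
    have "det (mat (Suc t) (Suc t) (\<lambda>(a, b). M a ((s(t := j)) b))) = 0"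
      unfolding M_def n[symmetric]
      by (rule det_select_delete_first_row[OF syz_matrix_carrier cof])
        (use s j in \<open>auto simp: n less_Suc_eq\<close>)
    then have "(\<Sum>i\<le>t. D i * M i j) = 0"
      unfolding det_bordered D_def cofactor_last_column .
    then have "(\<Sum>i<t. D i * M i j) + D t * M t j = 0" by (simp flip: lessThan_Suc_atMost)
    moreover have "(\<Sum>i<t. D i * M i j) = (\<Sum>i<t. D i * \<rho>s ! i $ j)"
      using M j by simp
    ultimately show ?thesis
      using j unfolding t_def[symmetric]
      by (simp add: M_last corner sum_negf eq_neg_iff_add_eq_0 add.commute)
  qed
  moreover have "i < n - 1 \<Longrightarrow> i \<le> t" for i by (simp add: t_def)
  ultimately show ?thesis by (intro exI[of _ "\<lambda>i. - D i"]) simp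
qed

lemma coprime_minors_imp_exact:
  assumes nonzero: "\<exists>J. J \<subseteq> {..n} \<and> card J = n - 1 \<and> minor J \<noteq> 0"
    and coprime: "\<And>p. prime_in S p \<Longrightarrow> \<exists>J. J \<subseteq> {..n} \<and> card J = n - 1 \<and> \<not> dvd_in S p (minor J)"
  shows "inj_on (syz_u n \<rho>s) coefficient_vecs"
    and "\<lbrakk>\<rho> \<in> syzygies n f; syz_v n f \<rho>s \<rho> = 0\<rbrakk> \<Longrightarrow> \<rho> \<in> syz_u n \<rho>s ` coefficient_vecs"
proof -
  obtain J where J: "J \<subseteq> {..n}" "card J = n - 1" "minor J \<noteq> 0" using nonzero by blast
  show "inj_on (syz_u n \<rho>s) coefficient_vecs"
  proof (rule inj_onI)
    fix a b assume ab: "a \<in> coefficient_vecs" "b \<in> coefficient_vecs" "syz_u n \<rho>s a = syz_u n \<rho>s b"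
    have "a $ i = b $ i" if "i < n - 1" for i
    proof (rule independent_of_minor[OF J _ that])
      fix j assume "j \<le> n"
      then show "(\<Sum>i<n - 1. a $ i * \<rho>s ! i $ j) = (\<Sum>i<n - 1. b $ i * \<rho>s ! i $ j)"
        using ab(3) syz_u_index[of j a] syz_u_index[of j b] by simp
    qed
    then show "a = b" using ab by (intro eq_vecI) (auto simp: coefficient_vecs_def)
  qed
  assume \<rho>: "\<rho> \<in> syzygies n f" "syz_v n f \<rho>s \<rho> = 0"
  \<comment> \<open>The coefficients \<open>b\<close> are universally quantified because cancelling
    a prime changes them.\<close>
  have "\<forall>b. (\<forall>i<n - 1. b i \<in> S) \<and> (\<forall>j\<le>n. c * \<rho> $ j = (\<Sum>i<n - 1. b i * \<rho>s ! i $ j)) \<longrightarrow>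
      \<rho> \<in> syz_u n \<rho>s ` coefficient_vecs" if "c \<in> S" "c \<noteq> 0" for c
    using that
  proof (induction rule: pb.factorial_induct)
    case (unit u)
    then obtain w where w: "w \<in> S" "1 = u * w" unfolding dvd_in_def by blast
    show ?case
    proof (intro allI impI)
      fix b assume b: "(\<forall>i<n - 1. b i \<in> S) \<and> (\<forall>j\<le>n. u * \<rho> $ j = (\<Sum>i<n - 1. b i * \<rho>s ! i $ j))"
      have "(\<Sum>i<n - 1. w * b i * \<rho>s ! i $ j) = \<rho> $ j" if "j \<le> n" for j
      proof -
        have "(\<Sum>i<n - 1. w * b i * \<rho>s ! i $ j) = w * (u * \<rho> $ j)"
          using b that by (simp add: sum_distrib_left mult.assoc)
        also have "\<dots> = (u * w) * \<rho> $ j" by (simp only: ac_simps)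
        finally show ?thesis by (simp flip: w(2))
      qed
      then have "syz_u n \<rho>s (vec (n - 1) (\<lambda>i. w * b i)) = \<rho>"
        using \<rho>(1) by (subst syz_u_eq_iff) (simp_all add: syzygies_iff)
      moreover have "vec (n - 1) (\<lambda>i. w * b i) \<in> coefficient_vecs"
        using b w by (intro vec_coefficient_vecs) auto
      ultimately show "\<rho> \<in> syz_u n \<rho>s ` coefficient_vecs" by (metis imageI)
    qed
  next
    case (prime p a)
    note p = prime_inD[OF prime.hyps(1)]
    show ?case
    proof (intro allI impI)
      fix b assume b: "(\<forall>i<n - 1. b i \<in> S) \<and> (\<forall>j\<le>n. p * a * \<rho> $ j = (\<Sum>i<n - 1. b i * \<rho>s ! i $ j))"
      obtain K where K: "K \<subseteq> {..n}" "card K = n - 1" "\<not> dvd_in S p (minor K)"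
        using coprime[OF prime.hyps(1)] by blast
      obtain e where e: "\<And>i. i < n - 1 \<Longrightarrow> e i \<in> S"
        "\<And>j. j \<le> n \<Longrightarrow> minor K * \<rho> $ j = (\<Sum>i<n - 1. e i * \<rho>s ! i $ j)"
        using minor_mult_kernel[OF \<rho> K(1,2)] by blast
      \<comment> \<open>Expressing minor(K) * p * a * \<open>\<rho>\<close> in two ways and
        comparing coefficients gives minor(K) * b_i = p * a * e_i, and p does not divide
        minor(K).\<close>
      have "dvd_in S p (b i)" if i: "i < n - 1" for i
      proof -
        have "minor K * b i = p * a * e i"
        proof (rule independent_of_minor[OF J _ i])
          fix j assume j: "j \<le> n"
          have "(\<Sum>i<n - 1. minor K * b i * \<rho>s ! i $ j) = minor K * (p * a * \<rho> $ j)"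
            using b j by (simp add: sum_distrib_left mult.assoc)
          also have "\<dots> = p * a * (minor K * \<rho> $ j)" by (simp add: ac_simps)
          also have "\<dots> = (\<Sum>i<n - 1. p * a * e i * \<rho>s ! i $ j)"
            using e(2)[OF j] by (simp add: sum_distrib_left mult.assoc)
          finally show "(\<Sum>i<n - 1. minor K * b i * \<rho>s ! i $ j) = (\<Sum>i<n - 1. p * a * e i * \<rho>s ! i $ j)" .
        qed
        then have "minor K * b i = p * (a * e i)" by (simp add: mult.assoc)
        then have "dvd_in S p (minor K * b i)"
          using e(1)[OF i] prime.hyps(2) unfolding dvd_in_def by blast
        then show ?thesis using p(4) K minor_closed b i by blast
      qed
      then have "\<forall>i. i < n - 1 \<longrightarrow> (\<exists>c. c \<in> S \<and> b i = p * c)" unfolding dvd_in_def by blast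
      then obtain b' where b': "\<And>i. i < n - 1 \<Longrightarrow> b' i \<in> S" "\<And>i. i < n - 1 \<Longrightarrow> b i = p * b' i"
        by metis
      have "a * \<rho> $ j = (\<Sum>i<n - 1. b' i * \<rho>s ! i $ j)" if "j \<le> n" for j
      proof -
        have "p * (a * \<rho> $ j) = p * (\<Sum>i<n - 1. b' i * \<rho>s ! i $ j)"
          using b that b'(2) by (simp add: sum_distrib_left mult.assoc)
        then show ?thesis using p(2) by simp
      qed
      then show "\<rho> \<in> syz_u n \<rho>s ` coefficient_vecs" using prime.IH b'(1) by blast
    qed
  qed
  moreover obtain e where "\<forall>i<n - 1. e i \<in> S" "\<forall>j\<le>n. minor J * \<rho> $ j = (\<Sum>i<n - 1. e i * \<rho>s ! i $ j)"
    using minor_mult_kernel[OF \<rho> J(1,2)] by blast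
  ultimately show "\<rho> \<in> syz_u n \<rho>s ` coefficient_vecs" using minor_closed[OF J(1,2)] J(3) by blast
qed

text \<open>Stated for a set \<open>P\<close> so that it serves both for {0}, giving linear
  dependence, and for the multiples of a prime, giving dependence modulo that prime.\<close>

lemma rows_dependent_mod_minors:
  assumes "1 \<notin> P" and mult: "\<And>a b. a \<in> P \<Longrightarrow> b \<in> S \<Longrightarrow> a * b \<in> P"
    and minors: "\<And>J. J \<subseteq> {..n} \<Longrightarrow> card J = n - 1 \<Longrightarrow> minor J \<in> P"
  shows "\<exists>c. (\<forall>i<n - 1. c i \<in> S) \<and> (\<exists>i<n - 1. c i \<notin> P) \<and>
    (\<forall>j\<le>n. (\<Sum>i<n - 1. c i * \<rho>s ! i $ j) \<in> P)"
proof (rule pb.rows_dependent_mod[OF assms(1)])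
  fix s :: "nat \<Rightarrow> nat" assume s: "\<And>b. b < n - 1 \<Longrightarrow> s b \<le> n"
  have "n - 1 \<le> n + 1" by simp
  then obtain J u where "J \<subseteq> {..n}" "card J = n - 1" "u \<in> S"
    "det (mat (n - 1) (n - 1) (\<lambda>(a, b). \<rho>s ! a $ s b)) = minor J * u"
    using pb.det_select_minor[of \<rho>s s n "Suc n"] s unfolding length_\<rho>s minor_def by blast
  then show "det (mat (n - 1) (n - 1) (\<lambda>(a, b). \<rho>s ! a $ s b)) \<in> P" using minors mult by simp
qed (rule nth_\<rho>s_closed)

lemma exact_imp_coprime_minors:
  assumes inj: "inj_on (syz_u n \<rho>s) coefficient_vecs"
    and kernel: "\<And>\<rho>. \<rho> \<in> syzygies n f \<Longrightarrow> syz_v n f \<rho>s \<rho> = 0 \<Longrightarrow> \<rho> \<in> syz_u n \<rho>s ` coefficient_vecs"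
  shows "\<exists>J. J \<subseteq> {..n} \<and> card J = n - 1 \<and> minor J \<noteq> 0"
    and "prime_in S p \<Longrightarrow> \<exists>J. J \<subseteq> {..n} \<and> card J = n - 1 \<and> \<not> dvd_in S p (minor J)"
proof -
  show "\<exists>J. J \<subseteq> {..n} \<and> card J = n - 1 \<and> minor J \<noteq> 0"
  proof (rule ccontr)
    assume "\<not> ?thesis"
    \<comment> \<open>If all minors vanish, the syzygies are linearly dependent over
      \<open>S\<close>, contradicting injectivity of u.\<close>
    then have "\<exists>c. (\<forall>i<n - 1. c i \<in> S) \<and> (\<exists>i<n - 1. c i \<notin> {0}) \<and>
        (\<forall>j\<le>n. (\<Sum>i<n - 1. c i * \<rho>s ! i $ j) \<in> {0})"
      by (intro rows_dependent_mod_minors) auto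
    then obtain c i where c: "\<forall>i<n - 1. c i \<in> S" "i < n - 1" "c i \<noteq> 0"
      "\<forall>j\<le>n. (\<Sum>i<n - 1. c i * \<rho>s ! i $ j) = 0" by auto
    have "syz_u n \<rho>s (vec (n - 1) c) = 0\<^sub>v (Suc n)" using c(4) by (subst syz_u_eq_iff) auto
    moreover have "syz_u n \<rho>s (vec (n - 1) (\<lambda>_. 0)) = 0\<^sub>v (Suc n)" by (subst syz_u_eq_iff) auto
    ultimately have "vec (n - 1) c = vec (n - 1) (\<lambda>_. 0)"
      using c(1) by (intro inj_onD[OF inj, of "vec (n - 1) c"]) (auto simp: coefficient_vecs_def)
    then have "vec (n - 1) c $ i = vec (n - 1) (\<lambda>_. 0) $ i" by simp
    then show False using c(2,3) by simp
  qed
  assume "prime_in S p"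
  note p = prime_inD[OF this]
  show "\<exists>J. J \<subseteq> {..n} \<and> card J = n - 1 \<and> \<not> dvd_in S p (minor J)"
  proof (rule ccontr)
    assume "\<not> ?thesis"
    then have "\<exists>c. (\<forall>i<n - 1. c i \<in> S) \<and> (\<exists>i<n - 1. c i \<notin> {x. dvd_in S p x}) \<and>
        (\<forall>j\<le>n. (\<Sum>i<n - 1. c i * \<rho>s ! i $ j) \<in> {x. dvd_in S p x})"
      using p(3) by (intro rows_dependent_mod_minors) (auto intro: pb.dvd_in_multL)
    then obtain c i where c: "\<forall>i<n - 1. c i \<in> S" "i < n - 1" "\<not> dvd_in S p (c i)"
      "\<forall>j\<le>n. dvd_in S p (\<Sum>i<n - 1. c i * \<rho>s ! i $ j)" by auto
    then have "\<forall>j\<in>{..n}. \<exists>x. x \<in> S \<and> (\<Sum>i<n - 1. c i * \<rho>s ! i $ j) = p * x"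
      unfolding dvd_in_def by blast
    from bchoice[OF this] obtain x where x: "\<And>j. j \<le> n \<Longrightarrow> x j \<in> S"
      "\<And>j. j \<le> n \<Longrightarrow> (\<Sum>i<n - 1. c i * \<rho>s ! i $ j) = p * x j" by auto
    define \<sigma> where "\<sigma> = vec (Suc n) x"
    have u_c: "syz_u n \<rho>s (vec (n - 1) c) = p \<cdot>\<^sub>v \<sigma>"
      using x(2) by (subst syz_u_eq_iff) (auto simp: \<sigma>_def)
    have "syz_u n \<rho>s (vec (n - 1) c) \<in> syzygies n f" using c(1) by (intro syz_u_syzygy) auto
    \<comment> \<open>Cancelling \<open>p\<close>, first in the syzygy equation and then in the
      value of v, puts \<open>\<sigma>\<close> into the kernel of v.\<close>
    then have "p * (\<Sum>j\<le>n. x j * partial_deriv j f) = 0"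
      unfolding u_c by (simp add: syzygies_iff \<sigma>_def sum_distrib_left mult.assoc cong: sum.cong_simp)
    then have \<sigma>: "\<sigma> \<in> syzygies n f"
      using p(2) x(1) by (simp add: syzygies_iff \<sigma>_def cong: sum.cong_simp)
    have "p * syz_v n f \<rho>s \<sigma> = syz_v n f \<rho>s (syz_u n \<rho>s (vec (n - 1) c))"
      unfolding u_c using syz_v_smult[OF p(1) \<sigma>] by simp
    also have "\<dots> = 0" using c(1) by (intro syz_v_syz_u) auto
    finally have "syz_v n f \<rho>s \<sigma> = 0" using p(2) by simp
    then obtain b where b: "b \<in> coefficient_vecs" "\<sigma> = syz_u n \<rho>s b" using kernel[OF \<sigma>] by blast
    \<comment> \<open>Both c and p * b are mapped to p * \<open>\<sigma>\<close>; injectivity makes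
      them equal, so \<open>p\<close> would divide every c_i.\<close>
    have "syz_u n \<rho>s (vec (n - 1) (\<lambda>i. p * b $ i)) = p \<cdot>\<^sub>v \<sigma>"
      using syz_u_carrier[of b] unfolding b(2)
      by (subst syz_u_eq_iff) (auto simp: syz_u_index sum_distrib_left mult.assoc)
    then have "vec (n - 1) c = vec (n - 1) (\<lambda>i. p * b $ i)"
      using c(1) b(1) p(1) u_c
      by (intro inj_onD[OF inj, of "vec (n - 1) c"]) (auto simp: coefficient_vecs_def)
    then have "vec (n - 1) c $ i = vec (n - 1) (\<lambda>i. p * b $ i) $ i" by simp
    then have "c i = p * b $ i" using c(2) by simp
    then show False using c(2,3) b(1) by (auto simp: coefficient_vecs_def dvd_in_def)
  qed
qed

lemma height_minors_ideal_ge_2_iff: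
  "2 \<le> ideal_height (poly_ring n) (minors_ideal n \<rho>s) \<longleftrightarrow>
    (\<exists>J. J \<subseteq> {..n} \<and> card J = n - 1 \<and> minor J \<noteq> 0) \<and>
    (\<forall>p. prime_in S p \<longrightarrow> (\<exists>J. J \<subseteq> {..n} \<and> card J = n - 1 \<and> \<not> dvd_in S p (minor J)))"
proof -
  have eq: "minors_ideal n \<rho>s = Idl\<^bsub>poly_ring n\<^esub> {minor J | J. J \<subseteq> {..n} \<and> card J = n - 1}"
    by (simp add: minors_ideal_def minor_def length_\<rho>s)
  have bex: "(\<exists>s\<in>{minor J | J. J \<subseteq> {..n} \<and> card J = n - 1}. P s) \<longleftrightarrow>
      (\<exists>J. J \<subseteq> {..n} \<and> card J = n - 1 \<and> P (minor J))" for P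
    by blast
  have "{minor J | J. J \<subseteq> {..n} \<and> card J = n - 1} \<subseteq> S" using minor_closed by blast
  from ideal_height_genideal_ge_2_iff[OF this] show ?thesis unfolding eq bex .
qed

end

theorem theorem3p3:
  fixes n d :: nat and f :: mpoly and G :: "mpoly vec set"
    and \<rho>s :: "mpoly vec list" and ds :: "nat list"
  assumes "n \<ge> 2" and "d \<ge> 3"
    and "f \<in> carrier (poly_ring n)" and "homogeneous (int d) f"
    and "square_free (poly_ring n) f"
    and "\<not> is_cone n f"
    and "minimal_homogeneous_generators (poly_ring n) (syzygy_module n f) G"
    and "length \<rho>s = n - 1" and "distinct \<rho>s" and "set \<rho>s \<subseteq> G"
    and "length ds = n - 1"
    and "\<And>j. j < n - 1 \<Longrightarrow> homogeneous_vec (int (ds ! j)) (\<rho>s ! j)"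
  shows "graded_short_exact (poly_ring n)
           (direct_sum (n - 1) (\<lambda>j. shift (poly_module n) (- int (ds ! j))))
           (syz_u n \<rho>s)
           (syzygy_module n f)
           (syz_v n f \<rho>s)
           (shift (bourbaki_module n f \<rho>s) (int (sum_list ds) - int d + 1))
         \<longleftrightarrow> ideal_height (poly_ring n) (minors_ideal n \<rho>s) \<ge> 2"
proof -
  have *: "set \<rho>s \<subseteq> syzygies n f" "0 < d"
    using assms(2,7,10) by (auto simp: minimal_homogeneous_generators_def generates_def syzygy_module_def)
  interpret jacobian_syzygies n d f \<rho>s
    by (rule jacobian_syzygies.intro[OF assms(1) *(2) assms(3-5,8) *(1)])
  have "\<forall>i<n - 1. homogeneous_vec (int (ds ! i)) (\<rho>s ! i)" using assms(12) by blast
  note exact_iff = graded_short_exact_iff[OF assms(11) this]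
  show ?thesis
    unfolding exact_iff height_minors_ideal_ge_2_iff
  proof (intro iffI conjI allI impI ballI; elim conjE)
    assume *: "inj_on (syz_u n \<rho>s) coefficient_vecs"
      "\<forall>\<rho>\<in>syzygies n f. syz_v n f \<rho>s \<rho> = 0 \<longrightarrow> \<rho> \<in> syz_u n \<rho>s ` coefficient_vecs"
    show "\<exists>J. J \<subseteq> {..n} \<and> card J = n - 1 \<and> minor J \<noteq> 0"
      by (rule exact_imp_coprime_minors(1)[OF *(1)]) (use *(2) in blast)
    fix p assume "prime_in S p"
    then show "\<exists>J. J \<subseteq> {..n} \<and> card J = n - 1 \<and> \<not> dvd_in S p (minor J)"
      by (rule exact_imp_coprime_minors(2)[OF *(1), rotated]) (use *(2) in blast)
  next
    assume *: "\<exists>J. J \<subseteq> {..n} \<and> card J = n - 1 \<and> minor J \<noteq> 0"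
      "\<forall>p. prime_in S p \<longrightarrow> (\<exists>J. J \<subseteq> {..n} \<and> card J = n - 1 \<and> \<not> dvd_in S p (minor J))"
    show "inj_on (syz_u n \<rho>s) coefficient_vecs"
      by (rule coprime_minors_imp_exact(1)[OF *(1)]) (use *(2) in blast)
    fix \<rho> assume "\<rho> \<in> syzygies n f" "syz_v n f \<rho>s \<rho> = 0"
    then show "\<rho> \<in> syz_u n \<rho>s ` coefficient_vecs"
      by (rule coprime_minors_imp_exact(2)[OF *(1), rotated]) (use *(2) in blast)
  qed
qed

end
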